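(* Let $T$ be an additive ternary $\Gamma$-ring. The category $T\text{-}\Gamma\mathrm{Mod}$ of left additive ternary $\Gamma$-modules over $T$ is canonically equivalent to the category of unital left $\mathcal A(T,\Gamma)$-modules.
   Context: A rng is an associative ring, not necessarily unital. An additive ternary $\Gamma$-ring consists of abelian groups $(T,+)$, $(\Gamma,+)$ and a map $T\times\Gamma\times T\times\Gamma\times T\to T$, $(x,\alpha,y,\beta,z)\mapsto x\alpha y\beta z$, additive in each of the five variables, with $(x\alpha y\beta z)\gamma u\delta v=x\alpha(y\beta z\gamma u)\delta v=x\alpha y\beta(z\gamma u\delta v)$. A left additive ternary $\Gamma$-module over $T$ is an abelian group $M$ with an action $T\times\Gamma\times T\times\Gamma\times M\to M$, $(a,\alpha,b,\beta,m)\mapsto a\alpha b\beta m$, additive in each of the five variables, with $(x\alpha y\beta z)\gamma u\delta m=x\alpha(y\beta z\gamma u)\delta m=x\alpha y\beta(z\gamma u\delta m)$ for all $x,y,z,u\in T$, $\alpha,\beta,\gamma,\delta\in\Gamma$, $m\in M$. Morphisms are additive maps preserving the action. Let $F(T,\Gamma)=T\otimes_{\mathbb Z}\Gamma\otimes_{\mathbb Z}T\otimes_{\mathbb Z}\Gamma$ with the associative bilinear multiplication $(a\otimes\alpha\otimes b\otimes\beta)(c\otimes\gamma\otimes d\otimes\delta)=(a\alpha b\beta c)\otimes\gamma\otimes d\otimes\delta$, let $J(T,\Gamma)$ be the two-sided ideal generated by all $(a\alpha b\beta c)\otimes\gamma\otimes d\otimes\delta-a\otimes\alpha\otimes(b\beta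 c\gamma d)\otimes\delta$, and let $\mathcal O(T,\Gamma)=F(T,\Gamma)/J(T,\Gamma)$. The unital ring $\mathcal A(T,\Gamma)=\mathbb Z\ltimes\mathcal O(T,\Gamma)$ is the Dorroh extension: the abelian group $\mathbb Z\oplus\mathcal O(T,\Gamma)$ with multiplication $(n,r)(m,s)=(nm,ns+mr+rs)$ and identity $(1,0)$. *)

theory Defs
  imports "HOL-Algebra.QuotRing" "HOL-Algebra.Module" "HOL-Algebra.Free_Abelian_Groups"
begin

section \<open>Categories and equivalences\<close>

text \<open>Categories are given by families of hom-sets that need not be disjoint; hence composition
  and the action of functors on morphisms take the objects involved as arguments:
  \<open>Comp C X Y Z g f\<close> is the composite of \<open>f : X \<rightarrow> Y\<close> and \<open>g : Y \<rightarrow> Z\<close>.\<close>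

record ('o, 'a) category =
  Ob :: "'o set"
  Hom :: "'o \<Rightarrow> 'o \<Rightarrow> 'a set"
  Ident :: "'o \<Rightarrow> 'a"
  Comp :: "'o \<Rightarrow> 'o \<Rightarrow> 'o \<Rightarrow> 'a \<Rightarrow> 'a \<Rightarrow> 'a"

locale category =
  fixes C :: "('o, 'a) category"
  assumes Ident_in_Hom: "X \<in> Ob C \<Longrightarrow> Ident C X \<in> Hom C X X"
    and Comp_in_Hom:
      "\<lbrakk>X \<in> Ob C; Y \<in> Ob C; Z \<in> Ob C; f \<in> Hom C X Y; g \<in> Hom C Y Z\<rbrakk>
       \<Longrightarrow> Comp C X Y Z g f \<in> Hom C X Z"
    and Comp_Ident_right:
      "\<lbrakk>X \<in> Ob C; Y \<in> Ob C; f \<in> Hom C X Y\<rbrakk> \<Longrightarrow> Comp C X X Y f (Ident C X) = f"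
    and Comp_Ident_left:
      "\<lbrakk>X \<in> Ob C; Y \<in> Ob C; f \<in> Hom C X Y\<rbrakk> \<Longrightarrow> Comp C X Y Y (Ident C Y) f = f"
    and Comp_assoc:
      "\<lbrakk>W \<in> Ob C; X \<in> Ob C; Y \<in> Ob C; Z \<in> Ob C;
        f \<in> Hom C W X; g \<in> Hom C X Y; h \<in> Hom C Y Z\<rbrakk>
       \<Longrightarrow> Comp C W X Z (Comp C X Y Z h g) f = Comp C W Y Z h (Comp C W X Y g f)"

record ('o, 'a, 'p, 'b) cat_functor =
  fobj :: "'o \<Rightarrow> 'p"
  fmor :: "'o \<Rightarrow> 'o \<Rightarrow> 'a \<Rightarrow> 'b"

locale cat_functor = C: category C + D: category D
  for C :: "('o, 'a) category" and D :: "('p, 'b) category" +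
  fixes F :: "('o, 'a, 'p, 'b) cat_functor"
  assumes fobj_in_Ob: "X \<in> Ob C \<Longrightarrow> fobj F X \<in> Ob D"
    and fmor_in_Hom:
      "\<lbrakk>X \<in> Ob C; Y \<in> Ob C; f \<in> Hom C X Y\<rbrakk>
       \<Longrightarrow> fmor F X Y f \<in> Hom D (fobj F X) (fobj F Y)"
    and fmor_Ident: "X \<in> Ob C \<Longrightarrow> fmor F X X (Ident C X) = Ident D (fobj F X)"
    and fmor_Comp:
      "\<lbrakk>X \<in> Ob C; Y \<in> Ob C; Z \<in> Ob C; f \<in> Hom C X Y; g \<in> Hom C Y Z\<rbrakk>
       \<Longrightarrow> fmor F X Z (Comp C X Y Z g f) =
           Comp D (fobj F X) (fobj F Y) (fobj F Z) (fmor F Y Z g) (fmor F X Y f)"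

definition id_functor :: "('o, 'a, 'o, 'a) cat_functor" where
  "id_functor = \<lparr>fobj = (\<lambda>X. X), fmor = (\<lambda>X Y f. f)\<rparr>"

definition comp_functor ::
    "('p, 'b, 'q, 'c) cat_functor \<Rightarrow> ('o, 'a, 'p, 'b) cat_functor \<Rightarrow> ('o, 'a, 'q, 'c) cat_functor"
  where "comp_functor G F =
    \<lparr>fobj = (\<lambda>X. fobj G (fobj F X)),
     fmor = (\<lambda>X Y f. fmor G (fobj F X) (fobj F Y) (fmor F X Y f))\<rparr>"

definition is_iso :: "('o, 'a) category \<Rightarrow> 'o \<Rightarrow> 'o \<Rightarrow> 'a \<Rightarrow> bool" where
  "is_iso C X Y f \<longleftrightarrow> f \<in> Hom C X Y \<and>
     (\<exists>g \<in> Hom C Y X. Comp C X Y X g f = Ident C X \<and> Comp C Y X Y f g = Ident C Y)"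

definition natural_iso ::
    "('o, 'a) category \<Rightarrow> ('p, 'b) category \<Rightarrow> ('o, 'a, 'p, 'b) cat_functor \<Rightarrow>
     ('o, 'a, 'p, 'b) cat_functor \<Rightarrow> ('o \<Rightarrow> 'b) \<Rightarrow> bool"
  where "natural_iso C D F G \<eta> \<longleftrightarrow>
    (\<forall>X \<in> Ob C. is_iso D (fobj F X) (fobj G X) (\<eta> X)) \<and>
    (\<forall>X \<in> Ob C. \<forall>Y \<in> Ob C. \<forall>f \<in> Hom C X Y.
       Comp D (fobj F X) (fobj F Y) (fobj G Y) (\<eta> Y) (fmor F X Y f) =
       Comp D (fobj F X) (fobj G X) (fobj G Y) (fmor G X Y f) (\<eta> X))"

definition equivalence_of_categories ::
    "('o, 'a) category \<Rightarrow> ('p, 'b) category \<Rightarrow> ('o, 'a, 'p, 'b) cat_functor \<Rightarrow>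
     ('p, 'b, 'o, 'a) cat_functor \<Rightarrow> bool"
  where "equivalence_of_categories C D F G \<longleftrightarrow>
    cat_functor C D F \<and> cat_functor D C G \<and>
    (\<exists>\<eta>. natural_iso C C id_functor (comp_functor G F) \<eta>) \<and>
    (\<exists>\<epsilon>. natural_iso D D (comp_functor F G) id_functor \<epsilon>)"


section \<open>Ternary \<open>\<Gamma>\<close>-rings and their modules\<close>

text \<open>Abelian groups are written as in \<^locale>\<open>abelian_group\<close>; the fields \<^const>\<open>monoid.mult\<close> and
  \<^const>\<open>monoid.one\<close> of the underlying records carry no meaning for \<open>T\<close>, \<open>\<Gamma>\<close> or modules.
  (As with \<^locale>\<open>module\<close>, two modules that differ only in these fields are distinct but
  canonically isomorphic objects.)\<close>

record ('t, 'g) tgamma_ring = "'t ring" +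
  tern :: "'t \<Rightarrow> 'g \<Rightarrow> 't \<Rightarrow> 'g \<Rightarrow> 't \<Rightarrow> 't"

locale ternary_gamma_ring = T: abelian_group T + G: abelian_group \<Gamma>
  for T :: "('t, 'g) tgamma_ring" and \<Gamma> :: "'g ring" +
  assumes tern_closed:
      "\<lbrakk>x \<in> carrier T; \<alpha> \<in> carrier \<Gamma>; y \<in> carrier T; \<beta> \<in> carrier \<Gamma>; z \<in> carrier T\<rbrakk>
       \<Longrightarrow> tern T x \<alpha> y \<beta> z \<in> carrier T"
    and tern_add1:
      "\<lbrakk>x \<in> carrier T; x' \<in> carrier T; \<alpha> \<in> carrier \<Gamma>; y \<in> carrier T; \<beta> \<in> carrier \<Gamma>; z \<in> carrier T\<rbrakk>
       \<Longrightarrow> tern T (x \<oplus>\<^bsub>T\<^esub> x') \<alpha> y \<beta> z = tern T x \<alpha> y \<beta> z \<oplus>\<^bsub>T\<^esub> tern T x' \<alpha> y \<beta> z"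
    and tern_add2:
      "\<lbrakk>x \<in> carrier T; \<alpha> \<in> carrier \<Gamma>; \<alpha>' \<in> carrier \<Gamma>; y \<in> carrier T; \<beta> \<in> carrier \<Gamma>; z \<in> carrier T\<rbrakk>
       \<Longrightarrow> tern T x (\<alpha> \<oplus>\<^bsub>\<Gamma>\<^esub> \<alpha>') y \<beta> z = tern T x \<alpha> y \<beta> z \<oplus>\<^bsub>T\<^esub> tern T x \<alpha>' y \<beta> z"
    and tern_add3:
      "\<lbrakk>x \<in> carrier T; \<alpha> \<in> carrier \<Gamma>; y \<in> carrier T; y' \<in> carrier T; \<beta> \<in> carrier \<Gamma>; z \<in> carrier T\<rbrakk>
       \<Longrightarrow> tern T x \<alpha> (y \<oplus>\<^bsub>T\<^esub> y') \<beta> z = tern T x \<alpha> y \<beta> z \<oplus>\<^bsub>T\<^esub> tern T x \<alpha> y' \<beta> z"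
    and tern_add4:
      "\<lbrakk>x \<in> carrier T; \<alpha> \<in> carrier \<Gamma>; y \<in> carrier T; \<beta> \<in> carrier \<Gamma>; \<beta>' \<in> carrier \<Gamma>; z \<in> carrier T\<rbrakk>
       \<Longrightarrow> tern T x \<alpha> y (\<beta> \<oplus>\<^bsub>\<Gamma>\<^esub> \<beta>') z = tern T x \<alpha> y \<beta> z \<oplus>\<^bsub>T\<^esub> tern T x \<alpha> y \<beta>' z"
    and tern_add5:
      "\<lbrakk>x \<in> carrier T; \<alpha> \<in> carrier \<Gamma>; y \<in> carrier T; \<beta> \<in> carrier \<Gamma>; z \<in> carrier T; z' \<in> carrier T\<rbrakk>
       \<Longrightarrow> tern T x \<alpha> y \<beta> (z \<oplus>\<^bsub>T\<^esub> z') = tern T x \<alpha> y \<beta> z \<oplus>\<^bsub>T\<^esub> tern T x \<alpha> y \<beta> z'"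
    and tern_assoc1:
      "\<lbrakk>x \<in> carrier T; y \<in> carrier T; z \<in> carrier T; u \<in> carrier T; v \<in> carrier T;
        \<alpha> \<in> carrier \<Gamma>; \<beta> \<in> carrier \<Gamma>; \<gamma> \<in> carrier \<Gamma>; \<delta> \<in> carrier \<Gamma>\<rbrakk>
       \<Longrightarrow> tern T (tern T x \<alpha> y \<beta> z) \<gamma> u \<delta> v = tern T x \<alpha> (tern T y \<beta> z \<gamma> u) \<delta> v"
    and tern_assoc2:
      "\<lbrakk>x \<in> carrier T; y \<in> carrier T; z \<in> carrier T; u \<in> carrier T; v \<in> carrier T;
        \<alpha> \<in> carrier \<Gamma>; \<beta> \<in> carrier \<Gamma>; \<gamma> \<in> carrier \<Gamma>; \<delta> \<in> carrier \<Gamma>\<rbrakk>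
       \<Longrightarrow> tern T x \<alpha> (tern T y \<beta> z \<gamma> u) \<delta> v = tern T x \<alpha> y \<beta> (tern T z \<gamma> u \<delta> v)"

record ('t, 'g, 'm) tgamma_module = "'m ring" +
  act :: "'t \<Rightarrow> 'g \<Rightarrow> 't \<Rightarrow> 'g \<Rightarrow> 'm \<Rightarrow> 'm"

locale ternary_gamma_module = ternary_gamma_ring T \<Gamma> + M: abelian_group M
  for T :: "('t, 'g) tgamma_ring" and \<Gamma> :: "'g ring" and M :: "('t, 'g, 'm) tgamma_module" +
  assumes act_closed:
      "\<lbrakk>a \<in> carrier T; \<alpha> \<in> carrier \<Gamma>; b \<in> carrier T; \<beta> \<in> carrier \<Gamma>; m \<in> carrier M\<rbrakk>
       \<Longrightarrow> act M a \<alpha> b \<beta> m \<in> carrier M"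
    and act_add1:
      "\<lbrakk>a \<in> carrier T; a' \<in> carrier T; \<alpha> \<in> carrier \<Gamma>; b \<in> carrier T; \<beta> \<in> carrier \<Gamma>; m \<in> carrier M\<rbrakk>
       \<Longrightarrow> act M (a \<oplus>\<^bsub>T\<^esub> a') \<alpha> b \<beta> m = act M a \<alpha> b \<beta> m \<oplus>\<^bsub>M\<^esub> act M a' \<alpha> b \<beta> m"
    and act_add2:
      "\<lbrakk>a \<in> carrier T; \<alpha> \<in> carrier \<Gamma>; \<alpha>' \<in> carrier \<Gamma>; b \<in> carrier T; \<beta> \<in> carrier \<Gamma>; m \<in> carrier M\<rbrakk>
       \<Longrightarrow> act M a (\<alpha> \<oplus>\<^bsub>\<Gamma>\<^esub> \<alpha>') b \<beta> m = act M a \<alpha> b \<beta> m \<oplus>\<^bsub>M\<^esub> act M a \<alpha>' b \<beta> m"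
    and act_add3:
      "\<lbrakk>a \<in> carrier T; \<alpha> \<in> carrier \<Gamma>; b \<in> carrier T; b' \<in> carrier T; \<beta> \<in> carrier \<Gamma>; m \<in> carrier M\<rbrakk>
       \<Longrightarrow> act M a \<alpha> (b \<oplus>\<^bsub>T\<^esub> b') \<beta> m = act M a \<alpha> b \<beta> m \<oplus>\<^bsub>M\<^esub> act M a \<alpha> b' \<beta> m"
    and act_add4:
      "\<lbrakk>a \<in> carrier T; \<alpha> \<in> carrier \<Gamma>; b \<in> carrier T; \<beta> \<in> carrier \<Gamma>; \<beta>' \<in> carrier \<Gamma>; m \<in> carrier M\<rbrakk>
       \<Longrightarrow> act M a \<alpha> b (\<beta> \<oplus>\<^bsub>\<Gamma>\<^esub> \<beta>') m = act M a \<alpha> b \<beta> m \<oplus>\<^bsub>M\<^esub> act M a \<alpha> b \<beta>' m"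
    and act_add5:
      "\<lbrakk>a \<in> carrier T; \<alpha> \<in> carrier \<Gamma>; b \<in> carrier T; \<beta> \<in> carrier \<Gamma>; m \<in> carrier M; m' \<in> carrier M\<rbrakk>
       \<Longrightarrow> act M a \<alpha> b \<beta> (m \<oplus>\<^bsub>M\<^esub> m') = act M a \<alpha> b \<beta> m \<oplus>\<^bsub>M\<^esub> act M a \<alpha> b \<beta> m'"
    and act_assoc1:
      "\<lbrakk>x \<in> carrier T; y \<in> carrier T; z \<in> carrier T; u \<in> carrier T; m \<in> carrier M;
        \<alpha> \<in> carrier \<Gamma>; \<beta> \<in> carrier \<Gamma>; \<gamma> \<in> carrier \<Gamma>; \<delta> \<in> carrier \<Gamma>\<rbrakk>
       \<Longrightarrow> act M (tern T x \<alpha> y \<beta> z) \<gamma> u \<delta> m = act M x \<alpha> (tern T y \<beta> z \<gamma> u) \<delta> m"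
    and act_assoc2:
      "\<lbrakk>x \<in> carrier T; y \<in> carrier T; z \<in> carrier T; u \<in> carrier T; m \<in> carrier M;
        \<alpha> \<in> carrier \<Gamma>; \<beta> \<in> carrier \<Gamma>; \<gamma> \<in> carrier \<Gamma>; \<delta> \<in> carrier \<Gamma>\<rbrakk>
       \<Longrightarrow> act M x \<alpha> (tern T y \<beta> z \<gamma> u) \<delta> m = act M x \<alpha> y \<beta> (act M z \<gamma> u \<delta> m)"

text \<open>Morphisms are extensional functions on the carrier, so that equality of morphisms is
  equality of maps.\<close>

definition tgamma_hom ::
    "('t, 'g) tgamma_ring \<Rightarrow> 'g ring \<Rightarrow> ('t, 'g, 'm) tgamma_module \<Rightarrow> ('t, 'g, 'm) tgamma_module \<Rightarrow>
     ('m \<Rightarrow> 'm) set"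
  where "tgamma_hom T \<Gamma> M N = {f \<in> carrier M \<rightarrow>\<^sub>E carrier N.
    (\<forall>m \<in> carrier M. \<forall>m' \<in> carrier M. f (m \<oplus>\<^bsub>M\<^esub> m') = f m \<oplus>\<^bsub>N\<^esub> f m') \<and>
    (\<forall>a \<in> carrier T. \<forall>\<alpha> \<in> carrier \<Gamma>. \<forall>b \<in> carrier T. \<forall>\<beta> \<in> carrier \<Gamma>. \<forall>m \<in> carrier M.
       f (act M a \<alpha> b \<beta> m) = act N a \<alpha> b \<beta> (f m))}"

definition TGammaMod ::
    "('t, 'g) tgamma_ring \<Rightarrow> 'g ring \<Rightarrow> (('t, 'g, 'm) tgamma_module, 'm \<Rightarrow> 'm) category"
  where "TGammaMod T \<Gamma> =
    \<lparr>Ob = {M. ternary_gamma_module T \<Gamma> M},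
     Hom = tgamma_hom T \<Gamma>,
     Ident = (\<lambda>M. \<lambda>m \<in> carrier M. m),
     Comp = (\<lambda>L M N g f. compose (carrier L) g f)\<rparr>"


section \<open>Unital left modules\<close>

text \<open>The library's \<^locale>\<open>module\<close> requires a commutative ring of scalars.\<close>

locale left_module = R?: ring R + M?: abelian_group M
  for R :: "'r ring" (structure) and M :: "('r, 'm) module" (structure) +
  assumes smult_closed:
      "\<lbrakk>a \<in> carrier R; x \<in> carrier M\<rbrakk> \<Longrightarrow> a \<odot>\<^bsub>M\<^esub> x \<in> carrier M"
    and smult_l_distr:
      "\<lbrakk>a \<in> carrier R; b \<in> carrier R; x \<in> carrier M\<rbrakk>
       \<Longrightarrow> (a \<oplus>\<^bsub>R\<^esub> b) \<odot>\<^bsub>M\<^esub> x = a \<odot>\<^bsub>M\<^esub> x \<oplus>\<^bsub>M\<^esub> b \<odot>\<^bsub>M\<^esub> x"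
    and smult_r_distr:
      "\<lbrakk>a \<in> carrier R; x \<in> carrier M; y \<in> carrier M\<rbrakk>
       \<Longrightarrow> a \<odot>\<^bsub>M\<^esub> (x \<oplus>\<^bsub>M\<^esub> y) = a \<odot>\<^bsub>M\<^esub> x \<oplus>\<^bsub>M\<^esub> a \<odot>\<^bsub>M\<^esub> y"
    and smult_assoc1:
      "\<lbrakk>a \<in> carrier R; b \<in> carrier R; x \<in> carrier M\<rbrakk>
       \<Longrightarrow> (a \<otimes>\<^bsub>R\<^esub> b) \<odot>\<^bsub>M\<^esub> x = a \<odot>\<^bsub>M\<^esub> (b \<odot>\<^bsub>M\<^esub> x)"
    and smult_one:
      "x \<in> carrier M \<Longrightarrow> \<one>\<^bsub>R\<^esub> \<odot>\<^bsub>M\<^esub> x = x"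

definition left_module_hom ::
    "'r ring \<Rightarrow> ('r, 'm) module \<Rightarrow> ('r, 'm) module \<Rightarrow> ('m \<Rightarrow> 'm) set"
  where "left_module_hom R M N = {f \<in> carrier M \<rightarrow>\<^sub>E carrier N.
    (\<forall>x \<in> carrier M. \<forall>y \<in> carrier M. f (x \<oplus>\<^bsub>M\<^esub> y) = f x \<oplus>\<^bsub>N\<^esub> f y) \<and>
    (\<forall>a \<in> carrier R. \<forall>x \<in> carrier M. f (a \<odot>\<^bsub>M\<^esub> x) = a \<odot>\<^bsub>N\<^esub> f x)}"

definition LeftMod :: "'r ring \<Rightarrow> (('r, 'm) module, 'm \<Rightarrow> 'm) category" where
  "LeftMod R =
    \<lparr>Ob = {M. left_module R M},
     Hom = left_module_hom R,
     Ident = (\<lambda>M. \<lambda>x \<in> carrier M. x),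
     Comp = (\<lambda>L M N g f. compose (carrier L) g f)\<rparr>"


section \<open>Rngs: generated ideals and the Dorroh extension\<close>

text \<open>Rngs are represented by ring records whose field \<^const>\<open>monoid.one\<close> carries no meaning.
  \<^const>\<open>FactRing\<close> forms quotients without using it, whereas \<^locale>\<open>ideal\<close> and \<^const>\<open>genideal\<close>
  presuppose a unital ring.\<close>

definition rng_ideal :: "'r set \<Rightarrow> 'r ring \<Rightarrow> bool" where
  "rng_ideal I R \<longleftrightarrow> additive_subgroup I R \<and>
     (\<forall>a \<in> I. \<forall>x \<in> carrier R. x \<otimes>\<^bsub>R\<^esub> a \<in> I \<and> a \<otimes>\<^bsub>R\<^esub> x \<in> I)"

definition rng_genideal :: "'r ring \<Rightarrow> 'r set \<Rightarrow> 'r set" where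
  "rng_genideal R S = \<Inter>{I. rng_ideal I R \<and> S \<subseteq> I}"

definition dorroh :: "'r ring \<Rightarrow> (int \<times> 'r) ring" where
  "dorroh R =
    \<lparr>carrier = UNIV \<times> carrier R,
     monoid.mult = (\<lambda>(n, r) (m, s). (n * m, ([n] \<cdot>\<^bsub>R\<^esub> s \<oplus>\<^bsub>R\<^esub> [m] \<cdot>\<^bsub>R\<^esub> r) \<oplus>\<^bsub>R\<^esub> r \<otimes>\<^bsub>R\<^esub> s)),
     one = (1, \<zero>\<^bsub>R\<^esub>),
     ring.zero = (0, \<zero>\<^bsub>R\<^esub>),
     add = (\<lambda>(n, r) (m, s). (n + m, r \<oplus>\<^bsub>R\<^esub> s))\<rparr>"


section \<open>The rngs \<open>F(T,\<Gamma>)\<close> and \<open>\<O>(T,\<Gamma>)\<close> and the ring \<open>\<A>(T,\<Gamma>)\<close>\<close>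

text \<open>The tensor product \<open>T \<otimes> \<Gamma> \<otimes> T \<otimes> \<Gamma>\<close> over the integers is the free abelian group on
  \<open>T \<times> \<Gamma> \<times> T \<times> \<Gamma>\<close> modulo the subgroup generated by the multilinearity relators.  Its
  multiplication is induced by the biadditive multiplication of the free abelian group with
  \<open>(a, \<alpha>, b, \<beta>) (c, \<gamma>, d, \<delta>) = (a \<alpha> b \<beta> c, \<gamma>, d, \<delta>)\<close> on generators.\<close>

type_synonym ('t, 'g) word = "'t \<times> 'g \<times> 't \<times> 'g"

definition words :: "('t, 'g) tgamma_ring \<Rightarrow> 'g ring \<Rightarrow> ('t, 'g) word set" where
  "words T \<Gamma> = carrier T \<times> carrier \<Gamma> \<times> carrier T \<times> carrier \<Gamma>"

definition word_mult :: "('t, 'g) tgamma_ring \<Rightarrow> ('t, 'g) word \<Rightarrow> ('t, 'g) word \<Rightarrow> ('t, 'g) word" where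
  "word_mult T = (\<lambda>(a, \<alpha>, b, \<beta>) (c, \<gamma>, d, \<delta>). (tern T a \<alpha> b \<beta> c, \<gamma>, d, \<delta>))"

definition free_rng :: "('t, 'g) tgamma_ring \<Rightarrow> 'g ring \<Rightarrow> (('t, 'g) word \<Rightarrow>\<^sub>0 int) ring" where
  "free_rng T \<Gamma> =
    \<lparr>carrier = carrier (free_Abelian_group (words T \<Gamma>)),
     monoid.mult = (\<lambda>p q. frag_extend (\<lambda>v. frag_extend (\<lambda>w. frag_of (word_mult T v w)) q) p),
     one = undefined,
     ring.zero = 0,
     add = (+)\<rparr>"

definition multilinear_relators ::
    "('t, 'g) tgamma_ring \<Rightarrow> 'g ring \<Rightarrow> (('t, 'g) word \<Rightarrow>\<^sub>0 int) set"
  where "multilinear_relators T \<Gamma> =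
    {frag_of (a \<oplus>\<^bsub>T\<^esub> a', \<alpha>, b, \<beta>) - frag_of (a, \<alpha>, b, \<beta>) - frag_of (a', \<alpha>, b, \<beta>) | a a' \<alpha> b \<beta>.
       a \<in> carrier T \<and> a' \<in> carrier T \<and> \<alpha> \<in> carrier \<Gamma> \<and> b \<in> carrier T \<and> \<beta> \<in> carrier \<Gamma>} \<union>
    {frag_of (a, \<alpha> \<oplus>\<^bsub>\<Gamma>\<^esub> \<alpha>', b, \<beta>) - frag_of (a, \<alpha>, b, \<beta>) - frag_of (a, \<alpha>', b, \<beta>) | a \<alpha> \<alpha>' b \<beta>.
       a \<in> carrier T \<and> \<alpha> \<in> carrier \<Gamma> \<and> \<alpha>' \<in> carrier \<Gamma> \<and> b \<in> carrier T \<and> \<beta> \<in> carrier \<Gamma>} \<union>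
    {frag_of (a, \<alpha>, b \<oplus>\<^bsub>T\<^esub> b', \<beta>) - frag_of (a, \<alpha>, b, \<beta>) - frag_of (a, \<alpha>, b', \<beta>) | a \<alpha> b b' \<beta>.
       a \<in> carrier T \<and> \<alpha> \<in> carrier \<Gamma> \<and> b \<in> carrier T \<and> b' \<in> carrier T \<and> \<beta> \<in> carrier \<Gamma>} \<union>
    {frag_of (a, \<alpha>, b, \<beta> \<oplus>\<^bsub>\<Gamma>\<^esub> \<beta>') - frag_of (a, \<alpha>, b, \<beta>) - frag_of (a, \<alpha>, b, \<beta>') | a \<alpha> b \<beta> \<beta>'.
       a \<in> carrier T \<and> \<alpha> \<in> carrier \<Gamma> \<and> b \<in> carrier T \<and> \<beta> \<in> carrier \<Gamma> \<and> \<beta>' \<in> carrier \<Gamma>}"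

definition tensor_relations ::
    "('t, 'g) tgamma_ring \<Rightarrow> 'g ring \<Rightarrow> (('t, 'g) word \<Rightarrow>\<^sub>0 int) set"
  where "tensor_relations T \<Gamma> =
    generate (free_Abelian_group (words T \<Gamma>)) (multilinear_relators T \<Gamma>)"

definition tensor_rng :: "('t, 'g) tgamma_ring \<Rightarrow> 'g ring \<Rightarrow> (('t, 'g) word \<Rightarrow>\<^sub>0 int) set ring" where
  "tensor_rng T \<Gamma> = free_rng T \<Gamma> Quot tensor_relations T \<Gamma>"

definition pure_tensor ::
    "('t, 'g) tgamma_ring \<Rightarrow> 'g ring \<Rightarrow> 't \<Rightarrow> 'g \<Rightarrow> 't \<Rightarrow> 'g \<Rightarrow> (('t, 'g) word \<Rightarrow>\<^sub>0 int) set"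
  where "pure_tensor T \<Gamma> a \<alpha> b \<beta> =
    tensor_relations T \<Gamma> +>\<^bsub>free_rng T \<Gamma>\<^esub> frag_of (a, \<alpha>, b, \<beta>)"

definition J_ideal :: "('t, 'g) tgamma_ring \<Rightarrow> 'g ring \<Rightarrow> (('t, 'g) word \<Rightarrow>\<^sub>0 int) set set" where
  "J_ideal T \<Gamma> = rng_genideal (tensor_rng T \<Gamma>)
    {pure_tensor T \<Gamma> (tern T a \<alpha> b \<beta> c) \<gamma> d \<delta> \<ominus>\<^bsub>tensor_rng T \<Gamma>\<^esub>
       pure_tensor T \<Gamma> a \<alpha> (tern T b \<beta> c \<gamma> d) \<delta> | a b c d \<alpha> \<beta> \<gamma> \<delta>.
       a \<in> carrier T \<and> b \<in> carrier T \<and> c \<in> carrier T \<and> d \<in> carrier T \<and>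
       \<alpha> \<in> carrier \<Gamma> \<and> \<beta> \<in> carrier \<Gamma> \<and> \<gamma> \<in> carrier \<Gamma> \<and> \<delta> \<in> carrier \<Gamma>}"

definition O_rng :: "('t, 'g) tgamma_ring \<Rightarrow> 'g ring \<Rightarrow> (('t, 'g) word \<Rightarrow>\<^sub>0 int) set set ring" where
  "O_rng T \<Gamma> = tensor_rng T \<Gamma> Quot J_ideal T \<Gamma>"

definition O_class ::
    "('t, 'g) tgamma_ring \<Rightarrow> 'g ring \<Rightarrow> 't \<Rightarrow> 'g \<Rightarrow> 't \<Rightarrow> 'g \<Rightarrow> (('t, 'g) word \<Rightarrow>\<^sub>0 int) set set"
  where "O_class T \<Gamma> a \<alpha> b \<beta> = J_ideal T \<Gamma> +>\<^bsub>tensor_rng T \<Gamma>\<^esub> pure_tensor T \<Gamma> a \<alpha> b \<beta>"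

definition A_ring ::
    "('t, 'g) tgamma_ring \<Rightarrow> 'g ring \<Rightarrow> (int \<times> (('t, 'g) word \<Rightarrow>\<^sub>0 int) set set) ring"
  where "A_ring T \<Gamma> = dorroh (O_rng T \<Gamma>)"


section \<open>The canonical functors\<close>

text \<open>From an \<open>\<A>(T,\<Gamma>)\<close>-module to a ternary \<open>\<Gamma>\<close>-module: \<open>a \<alpha> b \<beta> m = (0, [a \<otimes> \<alpha> \<otimes> b \<otimes> \<beta>]) m\<close>.\<close>

definition to_TGamma_module ::
    "('t, 'g) tgamma_ring \<Rightarrow> 'g ring \<Rightarrow> (int \<times> (('t, 'g) word \<Rightarrow>\<^sub>0 int) set set, 'm) module \<Rightarrow>
     ('t, 'g, 'm) tgamma_module"
  where "to_TGamma_module T \<Gamma> M =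
    \<lparr>carrier = carrier M, monoid.mult = monoid.mult M, one = one M, ring.zero = ring.zero M, add = add M,
     act = (\<lambda>a \<alpha> b \<beta> m. (0, O_class T \<Gamma> a \<alpha> b \<beta>) \<odot>\<^bsub>M\<^esub> m)\<rparr>"

definition to_TGamma_functor ::
    "('t, 'g) tgamma_ring \<Rightarrow> 'g ring \<Rightarrow>
     ((int \<times> (('t, 'g) word \<Rightarrow>\<^sub>0 int) set set, 'm) module, 'm \<Rightarrow> 'm,
      ('t, 'g, 'm) tgamma_module, 'm \<Rightarrow> 'm) cat_functor"
  where "to_TGamma_functor T \<Gamma> = \<lparr>fobj = to_TGamma_module T \<Gamma>, fmor = (\<lambda>M N f. f)\<rparr>"

text \<open>From a ternary \<open>\<Gamma>\<close>-module to an \<open>\<A>(T,\<Gamma>)\<close>-module: \<open>(n, r) m = n m + r m\<close>, where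
  \<open>[a \<otimes> \<alpha> \<otimes> b \<otimes> \<beta>] m = a \<alpha> b \<beta> m\<close>, extended additively.  An element \<open>r\<close> of \<open>\<O>(T,\<Gamma>)\<close> is a set
  of cosets in the free abelian group, so \<open>\<Union>r\<close> is the set of all formal sums that represent it.\<close>

definition free_act ::
    "('t, 'g, 'm) tgamma_module \<Rightarrow> (('t, 'g) word \<Rightarrow>\<^sub>0 int) \<Rightarrow> 'm \<Rightarrow> 'm"
  where "free_act M p m =
    (\<Oplus>\<^bsub>M\<^esub> w \<in> Poly_Mapping.keys p.
       [Poly_Mapping.lookup p w] \<cdot>\<^bsub>M\<^esub> (case w of (a, \<alpha>, b, \<beta>) \<Rightarrow> act M a \<alpha> b \<beta> m))"

definition O_act ::
    "('t, 'g, 'm) tgamma_module \<Rightarrow> (('t, 'g) word \<Rightarrow>\<^sub>0 int) set set \<Rightarrow> 'm \<Rightarrow> 'm"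
  where "O_act M r m = the_elem ((\<lambda>p. free_act M p m) ` \<Union>r)"

definition to_A_module ::
    "('t, 'g, 'm) tgamma_module \<Rightarrow> (int \<times> (('t, 'g) word \<Rightarrow>\<^sub>0 int) set set, 'm) module"
  where "to_A_module M =
    \<lparr>carrier = carrier M, monoid.mult = monoid.mult M, one = one M, ring.zero = ring.zero M, add = add M,
     smult = (\<lambda>(n, r) m. [n] \<cdot>\<^bsub>M\<^esub> m \<oplus>\<^bsub>M\<^esub> O_act M r m)\<rparr>"

definition to_A_functor ::
    "(('t, 'g, 'm) tgamma_module, 'm \<Rightarrow> 'm,
      (int \<times> (('t, 'g) word \<Rightarrow>\<^sub>0 int) set set, 'm) module, 'm \<Rightarrow> 'm) cat_functor"
  where "to_A_functor = \<lparr>fobj = to_A_module, fmor = (\<lambda>M N f. f)\<rparr>"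

end

(* Over any rng R, a unital left module over the Dorroh extension is the same as an abelian group with
   an additive associative action of R, because (n, r) = n (1, 0) + (0, r) and (1, 0) must act as the
   identity.  For R = O(T,Gamma), the formal sums of words that act as zero on a ternary module M form
   an ideal of the free rng; it contains the multilinearity relators, because the action is additive in
   each variable, and the differences generating J, by the first associativity law.  Hence the action
   of words descends to O(T,Gamma), and the two associativity laws together make it multiplicative.
   Conversely, the additive generators of O(T,Gamma) satisfy the ternary module laws.  Both functors
   are the identity on carriers and maps, so the unit and counit are identity maps; they are still
   isomorphisms between distinct objects, since the actions need only agree on carriers. *)

theory Submission
  imports Defs
begin

section \<open>Rngs, quotients and Dorroh extensions\<close>

lemma add_pow_int_zero [simp]: "[(0::int)] \<cdot>\<^bsub>R\<^esub> x = \<zero>\<^bsub>R\<^esub>"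
  by (simp add: add_pow_def)

locale rng = abelian_group R for R :: "'r ring" (structure) +
  assumes times_closed [simp]: "\<lbrakk>x \<in> carrier R; y \<in> carrier R\<rbrakk> \<Longrightarrow> x \<otimes> y \<in> carrier R"
    and times_assoc: "\<lbrakk>x \<in> carrier R; y \<in> carrier R; z \<in> carrier R\<rbrakk>
      \<Longrightarrow> (x \<otimes> y) \<otimes> z = x \<otimes> (y \<otimes> z)"
    and times_l_distr: "\<lbrakk>x \<in> carrier R; y \<in> carrier R; z \<in> carrier R\<rbrakk>
      \<Longrightarrow> (x \<oplus> y) \<otimes> z = x \<otimes> z \<oplus> y \<otimes> z"
    and times_r_distr: "\<lbrakk>x \<in> carrier R; y \<in> carrier R; z \<in> carrier R\<rbrakk>
      \<Longrightarrow> z \<otimes> (x \<oplus> y) = z \<otimes> x \<oplus> z \<otimes> y"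
begin

lemma times_zero_left [simp]:
  assumes "x \<in> carrier R" shows "\<zero> \<otimes> x = \<zero>"
  using times_l_distr[of \<zero> \<zero> x] assms by simp

lemma times_zero_right [simp]:
  assumes "x \<in> carrier R" shows "x \<otimes> \<zero> = \<zero>"
  using times_r_distr[of \<zero> \<zero> x] assms by simp

text \<open>Right multiplication by \<open>y\<close> is an endomorphism of the additive group, so it
  commutes with integer multiples.\<close>

lemma add_pow_times_left:
  assumes "x \<in> carrier R" "y \<in> carrier R"
  shows "([(n::int)] \<cdot> x) \<otimes> y = [n] \<cdot> (x \<otimes> y)"
proof -
  have "(\<lambda>x. x \<otimes> y) \<in> hom (add_monoid R) (add_monoid R)"
    using assms by (auto intro!: homI simp: times_l_distr)
  from hom_int_pow[OF this _ a_group a_group, of x n] show ?thesis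
    using assms by (simp add: add_pow_def)
qed

lemma add_pow_times_right:
  assumes "x \<in> carrier R" "y \<in> carrier R"
  shows "x \<otimes> ([(n::int)] \<cdot> y) = [n] \<cdot> (x \<otimes> y)"
proof -
  have "(\<lambda>y. x \<otimes> y) \<in> hom (add_monoid R) (add_monoid R)"
    using assms by (auto intro!: homI simp: times_r_distr)
  from hom_int_pow[OF this _ a_group a_group, of y n] show ?thesis
    using assms by (simp add: add_pow_def)
qed

text \<open>The mixed terms of a Dorroh product carry integer coefficients. Since integer multiples
  pass through products in \<open>R\<close>, both bracketings of a triple product expand to the same
  sum.\<close>

lemma ring_dorroh: "ring (dorroh R)"
proof (rule ringI)
  show "abelian_group (dorroh R)"
  proof (rule abelian_groupI)
    fix x assume "x \<in> carrier (dorroh R)"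
    then show "\<exists>y\<in>carrier (dorroh R). y \<oplus>\<^bsub>dorroh R\<^esub> x = \<zero>\<^bsub>dorroh R\<^esub>"
      by (intro bexI[of _ "(- fst x, \<ominus> snd x)"]) (auto simp: dorroh_def l_neg)
  qed (auto simp: dorroh_def a_ac)
  show "Group.monoid (dorroh R)"
  proof (rule monoidI)
    fix x y z
    assume "x \<in> carrier (dorroh R)" "y \<in> carrier (dorroh R)" "z \<in> carrier (dorroh R)"
    then show "x \<otimes>\<^bsub>dorroh R\<^esub> y \<otimes>\<^bsub>dorroh R\<^esub> z = x \<otimes>\<^bsub>dorroh R\<^esub> (y \<otimes>\<^bsub>dorroh R\<^esub> z)"
      by (auto simp: dorroh_def times_assoc times_l_distr times_r_distr add_pow_times_left
          add_pow_times_right add.int_pow_distrib add.int_pow_pow a_ac mult_ac)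
  qed (auto simp: dorroh_def)
qed (auto simp: dorroh_def times_l_distr times_r_distr add.int_pow_distrib a_ac
       add.int_pow_mult distrib_left distrib_right)

end

section \<open>Quotients of a rng by a two-sided ideal\<close>

locale rng_quotient = rng R for R :: "'r ring" (structure) +
  fixes I
  assumes ideal: "rng_ideal I R"
begin

sublocale abelian_subgroup I R
  using ideal abelian_group_axioms by (simp add: rng_ideal_def abelian_subgroupI3)

lemma ideal_times:
  assumes "a \<in> I" "x \<in> carrier R"
  shows "x \<otimes> a \<in> I" "a \<otimes> x \<in> I"
  using ideal assms by (auto simp: rng_ideal_def)

lemma carrier_Quot: "carrier (R Quot I) = (\<lambda>x. I +> x) ` carrier R"
  by (auto simp: FactRing_def A_RCOSETS_def')

lemma zero_Quot: "\<zero>\<^bsub>R Quot I\<^esub> = I +> \<zero>"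
  using a_subset by (simp add: FactRing_def)

lemma rcos_add:
  "\<lbrakk>x \<in> carrier R; y \<in> carrier R\<rbrakk> \<Longrightarrow> (I +> x) \<oplus>\<^bsub>R Quot I\<^esub> (I +> y) = I +> (x \<oplus> y)"
  by (simp add: FactRing_def a_rcos_sum)

text \<open>\<open>FactRing\<close> multiplies cosets by uniting the cosets of all products of
  representatives, so the point is that these cosets coincide.\<close>

lemma rcos_times:
  assumes "x \<in> carrier R" "y \<in> carrier R"
  shows "(I +> x) \<otimes>\<^bsub>R Quot I\<^esub> (I +> y) = I +> (x \<otimes> y)"
proof -
  have 1: "I +> (x' \<otimes> y') = I +> (x \<otimes> y)" if "x' \<in> I +> x" "y' \<in> I +> y" for x' y'
  proof -
    from that obtain h k where h: "h \<in> I" "x' = h \<oplus> x" and k: "k \<in> I" "y' = k \<oplus> y"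
      by (auto simp: a_r_coset_def')
    \<comment> \<open>Expanding \<open>(h \<oplus> x) \<otimes> (k \<oplus> y)\<close> leaves
      \<open>x \<otimes> y\<close> plus terms with a factor \<open>h\<close> or \<open>k\<close>
      from the ideal.\<close>
    have "x' \<otimes> y' = (h \<otimes> (k \<oplus> y) \<oplus> x \<otimes> k) \<oplus> x \<otimes> y"
      using h k assms by (simp add: times_l_distr times_r_distr a_ac)
    moreover have "h \<otimes> (k \<oplus> y) \<oplus> x \<otimes> k \<in> I"
      using h k assms by (simp add: ideal_times)
    ultimately have "x' \<otimes> y' \<in> I +> (x \<otimes> y)"
      by (auto simp: a_r_coset_def')
    then show ?thesis
      using a_repr_independence'[of "x' \<otimes> y'" "x \<otimes> y"] assms by simp
  qed
  have "x \<in> I +> x" "y \<in> I +> y"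
    using assms a_rcos_self by auto
  then have "(\<Union>a\<in>I +> x. \<Union>b\<in>I +> y. I +> a \<otimes> b) = I +> (x \<otimes> y)"
    using 1 by blast
  then show ?thesis
    by (simp add: FactRing_def rcoset_mult_def)
qed

lemma rng_Quot: "rng (R Quot I)"
proof (intro rng.intro rng_axioms.intro)
  show "abelian_group (R Quot I)"
    by (rule comm_group_abelian_groupI)
      (simp add: FactRing_def a_factorgroup_is_comm_group[unfolded A_FactGroup_def'])
qed (auto simp: carrier_Quot rcos_add rcos_times times_assoc times_l_distr times_r_distr)

lemma rcos_hom: "(\<lambda>x. I +> x) \<in> hom (add_monoid R) (add_monoid (R Quot I))"
  by (rule homI) (auto simp: carrier_Quot rcos_add)

lemma rcos_a_inv:
  assumes "x \<in> carrier R" shows "\<ominus>\<^bsub>R Quot I\<^esub> (I +> x) = I +> \<ominus> x"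
proof -
  interpret Q: rng "R Quot I" by (rule rng_Quot)
  show ?thesis
    using hom_in_carrier[OF rcos_hom, of x] hom_in_carrier[OF rcos_hom, of "\<ominus> x"] assms
    by (intro Q.minus_equality) (auto simp: rcos_add zero_Quot l_neg)
qed

end

section \<open>Recognising ideals, generating them and mapping them into quotients\<close>

lemma rng_idealI:
  assumes "abelian_group R" "K \<subseteq> carrier R" "\<zero>\<^bsub>R\<^esub> \<in> K"
    and "\<And>x y. \<lbrakk>x \<in> K; y \<in> K\<rbrakk> \<Longrightarrow> x \<oplus>\<^bsub>R\<^esub> y \<in> K"
    and "\<And>x. x \<in> K \<Longrightarrow> \<ominus>\<^bsub>R\<^esub> x \<in> K"
    and "\<And>a x. \<lbrakk>a \<in> K; x \<in> carrier R\<rbrakk> \<Longrightarrow> x \<otimes>\<^bsub>R\<^esub> a \<in> K"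
    and "\<And>a x. \<lbrakk>a \<in> K; x \<in> carrier R\<rbrakk> \<Longrightarrow> a \<otimes>\<^bsub>R\<^esub> x \<in> K"
  shows "rng_ideal K R"
  unfolding rng_ideal_def
proof (intro conjI ballI additive_subgroupI)
  interpret abelian_group R by fact
  show "subgroup K (add_monoid R)"
    using assms by (intro group.subgroupI[OF a_group]) (auto simp: a_inv_def)
qed (use assms in auto)

lemma (in rng) rng_ideal_carrier: "rng_ideal (carrier R) R"
  by (rule rng_idealI) (auto intro: abelian_group_axioms)

lemma (in rng) rng_ideal_genideal:
  assumes "S \<subseteq> carrier R"
  shows "rng_ideal (rng_genideal R S) R"
proof (rule rng_idealI)
  \<comment> \<open>The carrier is a member of the family; an intersection over an empty family
    would be the whole type.\<close>
  have carr: "rng_ideal (carrier R) R \<and> S \<subseteq> carrier R"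
    using rng_ideal_carrier assms by simp
  then show "rng_genideal R S \<subseteq> carrier R"
    unfolding rng_genideal_def by blast
qed (auto simp: rng_genideal_def rng_ideal_def additive_subgroup.zero_closed abelian_group_axioms
       additive_subgroup.a_closed additive_subgroup.a_inv_closed)

lemma rng_genideal_minimal:
  "\<lbrakk>rng_ideal K R; S \<subseteq> K\<rbrakk> \<Longrightarrow> rng_genideal R S \<subseteq> K"
  unfolding rng_genideal_def by blast

lemma rng_genideal_superset: "S \<subseteq> rng_genideal R S"
  unfolding rng_genideal_def by blast

text \<open>The quotient map is onto, so every factor from the quotient lifts to \<open>R\<close>
  and is absorbed by \<open>K\<close> there.\<close>

lemma (in rng_quotient) rng_ideal_rcos_image:
  assumes "rng_ideal K R"
  shows "rng_ideal ((\<lambda>x. I +> x) ` K) (R Quot I)"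
proof -
  interpret K: rng_quotient R K
    using assms by unfold_locales
  interpret Q: rng "R Quot I" by (rule rng_Quot)
  note K.a_Hcarr[simp]
  show ?thesis
  proof (rule rng_idealI)
    show "(\<lambda>x. I +> x) ` K \<subseteq> carrier (R Quot I)"
      by (auto simp: carrier_Quot)
    fix a x assume "a \<in> (\<lambda>x. I +> x) ` K" "x \<in> carrier (R Quot I)"
    then show "x \<otimes>\<^bsub>R Quot I\<^esub> a \<in> (\<lambda>x. I +> x) ` K" "a \<otimes>\<^bsub>R Quot I\<^esub> x \<in> (\<lambda>x. I +> x) ` K"
      by (auto simp: carrier_Quot rcos_times K.ideal_times)
  qed (auto simp: zero_Quot rcos_add rcos_a_inv Q.abelian_group_axioms)
qed

section \<open>Rng actions on abelian groups, and modules over the Dorroh extension\<close>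

locale rng_action = rng R + M: abelian_group M
  for R :: "'r ring" (structure) and M :: "('m, 'x) ring_scheme" +
  fixes ract
  assumes ract_closed [simp]: "\<lbrakk>r \<in> carrier R; m \<in> carrier M\<rbrakk> \<Longrightarrow> ract r m \<in> carrier M"
    and ract_l_distr: "\<lbrakk>r \<in> carrier R; s \<in> carrier R; m \<in> carrier M\<rbrakk>
      \<Longrightarrow> ract (r \<oplus> s) m = ract r m \<oplus>\<^bsub>M\<^esub> ract s m"
    and ract_r_distr: "\<lbrakk>r \<in> carrier R; m \<in> carrier M; m' \<in> carrier M\<rbrakk>
      \<Longrightarrow> ract r (m \<oplus>\<^bsub>M\<^esub> m') = ract r m \<oplus>\<^bsub>M\<^esub> ract r m'"
    and ract_assoc: "\<lbrakk>r \<in> carrier R; s \<in> carrier R; m \<in> carrier M\<rbrakk>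
      \<Longrightarrow> ract (r \<otimes> s) m = ract r (ract s m)"
begin

lemma ract_zero [simp]:
  assumes "m \<in> carrier M" shows "ract \<zero> m = \<zero>\<^bsub>M\<^esub>"
  using ract_l_distr[of \<zero> \<zero> m] assms by simp

lemma ract_add_pow_left:
  assumes "r \<in> carrier R" "m \<in> carrier M"
  shows "ract ([(n::int)] \<cdot> r) m = [n] \<cdot>\<^bsub>M\<^esub> ract r m"
proof -
  have "(\<lambda>r. ract r m) \<in> hom (add_monoid R) (add_monoid M)"
    using assms by (auto intro!: homI simp: ract_l_distr)
  from hom_int_pow[OF this _ a_group M.a_group, of r n] show ?thesis
    using assms by (simp add: add_pow_def)
qed

lemma ract_add_pow_right:
  assumes "r \<in> carrier R" "m \<in> carrier M"
  shows "ract r ([(n::int)] \<cdot>\<^bsub>M\<^esub> m) = [n] \<cdot>\<^bsub>M\<^esub> ract r m"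
proof -
  have "(\<lambda>m. ract r m) \<in> hom (add_monoid M) (add_monoid M)"
    using assms by (auto intro!: homI simp: ract_r_distr)
  from hom_int_pow[OF this _ M.a_group M.a_group, of m n] show ?thesis
    using assms by (simp add: add_pow_def)
qed

end

text \<open>The four terms of \<open>a \<odot> (b \<odot> x)\<close> are exactly those of the Dorroh
  product acting on \<open>x\<close>; the identity \<open>(1, \<zero>)\<close> acts trivially
  because \<open>ract \<zero>\<close> vanishes.\<close>

lemma left_module_dorrohI:
  assumes "rng_action R M ract"
    and smult: "\<And>n r m. \<lbrakk>r \<in> carrier R; m \<in> carrier M\<rbrakk>
      \<Longrightarrow> (n, r) \<odot>\<^bsub>M\<^esub> m = [n] \<cdot>\<^bsub>M\<^esub> m \<oplus>\<^bsub>M\<^esub> ract r m"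
  shows "left_module (dorroh R) M"
proof -
  interpret rng_action R M ract by fact
  show ?thesis
  proof (intro left_module.intro left_module_axioms.intro ring_dorroh M.abelian_group_axioms)
    fix a b x assume "a \<in> carrier (dorroh R)" "b \<in> carrier (dorroh R)" "x \<in> carrier M"
    then show "a \<otimes>\<^bsub>dorroh R\<^esub> b \<odot>\<^bsub>M\<^esub> x = a \<odot>\<^bsub>M\<^esub> (b \<odot>\<^bsub>M\<^esub> x)"
      by (auto simp: dorroh_def smult ract_l_distr ract_r_distr ract_assoc
        ract_add_pow_left ract_add_pow_right M.add.int_pow_distrib M.add.int_pow_pow M.a_ac mult_ac)
  qed (auto simp: dorroh_def smult ract_l_distr ract_r_distr M.add.int_pow_distrib
       M.add.int_pow_mult M.a_ac)
qed

text \<open>The integers are generated by 1. This determines the action of the integer part of a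
  Dorroh extension from that of its identity.\<close>

lemma (in abelian_group) eq_add_pow_int:
  assumes f: "\<And>n. f n \<in> carrier G" and add: "\<And>m n. f (m + n) = f m \<oplus> f n"
  shows "f (n::int) = [n] \<cdot> f 1"
proof (induction n rule: int_induct[of _ 0])
  case base
  show ?case
    using add[of 0 0] f by simp
next
  case (step1 i)
  then show ?case
    using f by (simp add: add add.int_pow_mult)
next
  case (step2 i)
  \<comment> \<open>Downwards, the claim at \<open>i - 1\<close> follows from the one at
    \<open>i\<close> by cancelling \<open>f 1\<close>.\<close>
  have "f (i - 1) \<oplus> f 1 = [(i - 1)] \<cdot> f 1 \<oplus> f 1"
    using step2 f add[of "i - 1" 1] add.int_pow_mult[of "f 1" "i - 1" 1] by simp
  then show ?case
    using f by simp
qed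

section \<open>The rng \<open>\<O>(T,\<Gamma>)\<close> as a quotient of the free rng\<close>

text \<open>This uniqueness principle is the main tool for formal sums: an identity between additive
  expressions in \<open>p\<close> need only be checked on words.\<close>

lemma hom_free_Abelian_group_eqI:
  assumes "group H" "f \<in> hom (free_Abelian_group S) H" "g \<in> hom (free_Abelian_group S) H"
    and eq: "\<And>a. a \<in> S \<Longrightarrow> f (frag_of a) = g (frag_of a)"
    and p: "Poly_Mapping.keys p \<subseteq> S"
  shows "f p = g p"
proof -
  interpret f: group_hom "free_Abelian_group S" H f
    using assms by (simp add: group_hom_def group_hom_axioms_def)
  interpret g: group_hom "free_Abelian_group S" H g
    using assms by (simp add: group_hom_def group_hom_axioms_def)
  from p show ?thesis
  proof (rule free_Abelian_group_induct[where P = "\<lambda>p. f p = g p"])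
    show "f 0 = g 0"
      using f.hom_one g.hom_one by simp
  next
    fix x y
    assume "Poly_Mapping.keys x \<subseteq> S" "Poly_Mapping.keys y \<subseteq> S" "f x = g x" "f y = g y"
    \<comment> \<open>The induction closes under differences, whereas \<open>f\<close> and
      \<open>g\<close> are known on sums and inverses.\<close>
    then have "f (x + - y) = g (x + - y)"
      using f.hom_mult[of x "- y"] g.hom_mult[of x "- y"] f.hom_inv[of y] g.hom_inv[of y] by simp
    then show "f (x - y) = g (x - y)" by simp
  qed (rule eq)
qed

text \<open>The product of the free rng nests two copies of \<open>frag_extend\<close>; additivity
  in the function argument carries additivity in the right factor through the outer copy.\<close>

lemma frag_extend_fun_add:
  "frag_extend (\<lambda>x. f x + g x) p = frag_extend f p + frag_extend g p"
  using subset_UNIV by (induction p rule: frag_induction) (auto simp: frag_extend_diff)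

lemma frag_extend_fun_diff:
  "frag_extend (\<lambda>x. f x - g x) p = frag_extend f p - frag_extend g p"
  using subset_UNIV by (induction p rule: frag_induction) (auto simp: frag_extend_diff)

section \<open>The free rng on words and the multilinearity relators\<close>

lemma free_rng_simps [simp]:
  "carrier (free_rng T \<Gamma>) = {p. Poly_Mapping.keys p \<subseteq> words T \<Gamma>}"
  "p \<oplus>\<^bsub>free_rng T \<Gamma>\<^esub> q = p + q"
  "\<zero>\<^bsub>free_rng T \<Gamma>\<^esub> = 0"
  "frag_of v \<otimes>\<^bsub>free_rng T \<Gamma>\<^esub> frag_of w = frag_of (word_mult T v w)"
  "0 \<otimes>\<^bsub>free_rng T \<Gamma>\<^esub> q = 0"
  "p \<otimes>\<^bsub>free_rng T \<Gamma>\<^esub> 0 = 0"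
  by (auto simp: free_rng_def intro: frag_extend_eq_0)

lemma free_rng_distrib:
  "(p + p') \<otimes>\<^bsub>free_rng T \<Gamma>\<^esub> q = p \<otimes>\<^bsub>free_rng T \<Gamma>\<^esub> q + p' \<otimes>\<^bsub>free_rng T \<Gamma>\<^esub> q"
  "(p - p') \<otimes>\<^bsub>free_rng T \<Gamma>\<^esub> q = p \<otimes>\<^bsub>free_rng T \<Gamma>\<^esub> q - p' \<otimes>\<^bsub>free_rng T \<Gamma>\<^esub> q"
  "p \<otimes>\<^bsub>free_rng T \<Gamma>\<^esub> (q + q') = p \<otimes>\<^bsub>free_rng T \<Gamma>\<^esub> q + p \<otimes>\<^bsub>free_rng T \<Gamma>\<^esub> q'"
  "p \<otimes>\<^bsub>free_rng T \<Gamma>\<^esub> (q - q') = p \<otimes>\<^bsub>free_rng T \<Gamma>\<^esub> q - p \<otimes>\<^bsub>free_rng T \<Gamma>\<^esub> q'"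
  by (simp_all add: free_rng_def frag_extend_add frag_extend_diff frag_extend_fun_add frag_extend_fun_diff)

lemma add_monoid_free_rng: "add_monoid (free_rng T \<Gamma>) = free_Abelian_group (words T \<Gamma>)"
  by (simp add: free_rng_def free_Abelian_group_def)

lemma abelian_group_free_rng: "abelian_group (free_rng T \<Gamma>)"
  by (rule comm_group_abelian_groupI) (simp only: add_monoid_free_rng abelian_free_Abelian_group)

lemma a_inv_free_rng [simp]:
  "Poly_Mapping.keys p \<subseteq> words T \<Gamma> \<Longrightarrow> \<ominus>\<^bsub>free_rng T \<Gamma>\<^esub> p = - p"
  by (simp only: a_inv_def add_monoid_free_rng inv_free_Abelian_group)

lemma multilinear_relatorsE:
  assumes "r \<in> multilinear_relators T \<Gamma>"
  obtains
    (1) a a' \<alpha> b \<beta> where "a \<in> carrier T" "a' \<in> carrier T" "\<alpha> \<in> carrier \<Gamma>" "b \<in> carrier T" "\<beta> \<in> carrier \<Gamma>"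
      "r = frag_of (a \<oplus>\<^bsub>T\<^esub> a', \<alpha>, b, \<beta>) - frag_of (a, \<alpha>, b, \<beta>) - frag_of (a', \<alpha>, b, \<beta>)"
  | (2) a \<alpha> \<alpha>' b \<beta> where "a \<in> carrier T" "\<alpha> \<in> carrier \<Gamma>" "\<alpha>' \<in> carrier \<Gamma>" "b \<in> carrier T" "\<beta> \<in> carrier \<Gamma>"
      "r = frag_of (a, \<alpha> \<oplus>\<^bsub>\<Gamma>\<^esub> \<alpha>', b, \<beta>) - frag_of (a, \<alpha>, b, \<beta>) - frag_of (a, \<alpha>', b, \<beta>)"
  | (3) a \<alpha> b b' \<beta> where "a \<in> carrier T" "\<alpha> \<in> carrier \<Gamma>" "b \<in> carrier T" "b' \<in> carrier T" "\<beta> \<in> carrier \<Gamma>"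
      "r = frag_of (a, \<alpha>, b \<oplus>\<^bsub>T\<^esub> b', \<beta>) - frag_of (a, \<alpha>, b, \<beta>) - frag_of (a, \<alpha>, b', \<beta>)"
  | (4) a \<alpha> b \<beta> \<beta>' where "a \<in> carrier T" "\<alpha> \<in> carrier \<Gamma>" "b \<in> carrier T" "\<beta> \<in> carrier \<Gamma>" "\<beta>' \<in> carrier \<Gamma>"
      "r = frag_of (a, \<alpha>, b, \<beta> \<oplus>\<^bsub>\<Gamma>\<^esub> \<beta>') - frag_of (a, \<alpha>, b, \<beta>) - frag_of (a, \<alpha>, b, \<beta>')"
  using assms unfolding multilinear_relators_def by (elim UnE CollectE exE conjE) (erule (5) that)+

lemma multilinear_relatorsI:
  "\<lbrakk>a \<in> carrier T; a' \<in> carrier T; \<alpha> \<in> carrier \<Gamma>; b \<in> carrier T; \<beta> \<in> carrier \<Gamma>\<rbrakk> \<Longrightarrow>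
    frag_of (a \<oplus>\<^bsub>T\<^esub> a', \<alpha>, b, \<beta>) - frag_of (a, \<alpha>, b, \<beta>) - frag_of (a', \<alpha>, b, \<beta>)
      \<in> multilinear_relators T \<Gamma>"
  "\<lbrakk>a \<in> carrier T; \<alpha> \<in> carrier \<Gamma>; \<alpha>' \<in> carrier \<Gamma>; b \<in> carrier T; \<beta> \<in> carrier \<Gamma>\<rbrakk> \<Longrightarrow>
    frag_of (a, \<alpha> \<oplus>\<^bsub>\<Gamma>\<^esub> \<alpha>', b, \<beta>) - frag_of (a, \<alpha>, b, \<beta>) - frag_of (a, \<alpha>', b, \<beta>)
      \<in> multilinear_relators T \<Gamma>"
  "\<lbrakk>a \<in> carrier T; \<alpha> \<in> carrier \<Gamma>; b \<in> carrier T; b' \<in> carrier T; \<beta> \<in> carrier \<Gamma>\<rbrakk> \<Longrightarrow>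
    frag_of (a, \<alpha>, b \<oplus>\<^bsub>T\<^esub> b', \<beta>) - frag_of (a, \<alpha>, b, \<beta>) - frag_of (a, \<alpha>, b', \<beta>)
      \<in> multilinear_relators T \<Gamma>"
  "\<lbrakk>a \<in> carrier T; \<alpha> \<in> carrier \<Gamma>; b \<in> carrier T; \<beta> \<in> carrier \<Gamma>; \<beta>' \<in> carrier \<Gamma>\<rbrakk> \<Longrightarrow>
    frag_of (a, \<alpha>, b, \<beta> \<oplus>\<^bsub>\<Gamma>\<^esub> \<beta>') - frag_of (a, \<alpha>, b, \<beta>) - frag_of (a, \<alpha>, b, \<beta>')
      \<in> multilinear_relators T \<Gamma>"
  unfolding multilinear_relators_def by blast+

context ternary_gamma_ring
begin

lemma word_mult_in_words: "\<lbrakk>v \<in> words T \<Gamma>; w \<in> words T \<Gamma>\<rbrakk> \<Longrightarrow> word_mult T v w \<in> words T \<Gamma>"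
  by (auto simp: words_def word_mult_def tern_closed)

lemma word_mult_assoc:
  "\<lbrakk>u \<in> words T \<Gamma>; v \<in> words T \<Gamma>; w \<in> words T \<Gamma>\<rbrakk>
    \<Longrightarrow> word_mult T (word_mult T u v) w = word_mult T u (word_mult T v w)"
  by (auto simp: words_def word_mult_def tern_assoc1 tern_assoc2)

lemma multilinear_relators_carrier:
  "r \<in> multilinear_relators T \<Gamma> \<Longrightarrow> Poly_Mapping.keys r \<subseteq> words T \<Gamma>"
  by (erule multilinear_relatorsE; simp) (intro order_trans[OF keys_diff] Un_least; simp add: words_def)+

lemma rng_free_rng: "rng (free_rng T \<Gamma>)"
proof (intro rng.intro rng_axioms.intro abelian_group_free_rng)
  fix p q
  assume "p \<in> carrier (free_rng T \<Gamma>)" "q \<in> carrier (free_rng T \<Gamma>)"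
  then show "p \<otimes>\<^bsub>free_rng T \<Gamma>\<^esub> q \<in> carrier (free_rng T \<Gamma>)"
    unfolding free_rng_simps mem_Collect_eq
    by (simp only: free_rng_def monoid.simps)
      (intro order_trans[OF keys_frag_extend] UN_least; auto dest!: subsetD simp: word_mult_in_words)
next
  fix p q r
  assume "p \<in> carrier (free_rng T \<Gamma>)" "q \<in> carrier (free_rng T \<Gamma>)" "r \<in> carrier (free_rng T \<Gamma>)"
  then have p: "Poly_Mapping.keys p \<subseteq> words T \<Gamma>" and q: "Poly_Mapping.keys q \<subseteq> words T \<Gamma>"
    and r: "Poly_Mapping.keys r \<subseteq> words T \<Gamma>" by auto
  from p show "p \<otimes>\<^bsub>free_rng T \<Gamma>\<^esub> q \<otimes>\<^bsub>free_rng T \<Gamma>\<^esub> r = p \<otimes>\<^bsub>free_rng T \<Gamma>\<^esub> (q \<otimes>\<^bsub>free_rng T \<Gamma>\<^esub> r)"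
  \<comment> \<open>Both sides are additive in each factor, so three nested inductions reduce the
    claim to associativity of \<open>word_mult\<close>.\<close>
  proof (induction p rule: frag_induction)
    case (one u)
    from q show ?case
    proof (induction q rule: frag_induction)
      case (one v)
      from r show ?case
        by (induction r rule: frag_induction) (use \<open>u \<in> _\<close> one in \<open>auto simp: free_rng_distrib word_mult_assoc\<close>)
    qed (auto simp: free_rng_distrib)
  qed (auto simp: free_rng_distrib)
qed (auto simp: free_rng_distrib)

sublocale free: rng "free_rng T \<Gamma>"
  by (rule rng_free_rng)

text \<open>From the left, \<open>w\<close> changes only the first entry, and
  \<open>tern_add5\<close> keeps relators in that entry relators. From the right, all of
  \<open>r\<close> is absorbed into the first entry, so additivity of \<open>tern\<close> in its
  first four arguments yields a relator in the first variable.\<close>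

lemma multilinear_relators_word_mult:
  assumes "r \<in> multilinear_relators T \<Gamma>" "w \<in> words T \<Gamma>"
  shows "frag_of w \<otimes>\<^bsub>free_rng T \<Gamma>\<^esub> r \<in> multilinear_relators T \<Gamma>"
    and "r \<otimes>\<^bsub>free_rng T \<Gamma>\<^esub> frag_of w \<in> multilinear_relators T \<Gamma>"
proof -
  obtain x \<xi> y \<eta> where w: "w = (x, \<xi>, y, \<eta>)"
    "x \<in> carrier T" "\<xi> \<in> carrier \<Gamma>" "y \<in> carrier T" "\<eta> \<in> carrier \<Gamma>"
    using assms(2) by (auto simp: words_def)
  from assms(1) show "frag_of w \<otimes>\<^bsub>free_rng T \<Gamma>\<^esub> r \<in> multilinear_relators T \<Gamma>"
    by (cases rule: multilinear_relatorsE)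
      (simp_all add: w free_rng_distrib word_mult_def tern_closed tern_add5 multilinear_relatorsI)
  from assms(1) show "r \<otimes>\<^bsub>free_rng T \<Gamma>\<^esub> frag_of w \<in> multilinear_relators T \<Gamma>"
    by (cases rule: multilinear_relatorsE)
      (simp_all add: w free_rng_distrib word_mult_def tern_closed tern_add1 tern_add2 tern_add3 tern_add4
        multilinear_relatorsI)
qed

lemma additive_subgroup_tensor_relations: "additive_subgroup (tensor_relations T \<Gamma>) (free_rng T \<Gamma>)"
  unfolding tensor_relations_def additive_subgroup_def add_monoid_free_rng
  using multilinear_relators_carrier
  by (intro group.generate_is_subgroup[OF group_free_Abelian_group]) auto

lemma tensor_relations_minimal:
  assumes "additive_subgroup K (free_rng T \<Gamma>)" "multilinear_relators T \<Gamma> \<subseteq> K"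
  shows "tensor_relations T \<Gamma> \<subseteq> K"
  using assms unfolding tensor_relations_def additive_subgroup_def add_monoid_free_rng
  by (intro group.generate_subgroup_incl[OF group_free_Abelian_group])

lemma multilinear_relators_subset: "multilinear_relators T \<Gamma> \<subseteq> tensor_relations T \<Gamma>"
  unfolding tensor_relations_def by (auto intro: generate.incl)

text \<open>The relations are generated only as a subgroup; that they form an ideal is what makes
  the product descend to the tensor product.\<close>

lemma rng_ideal_tensor_relations: "rng_ideal (tensor_relations T \<Gamma>) (free_rng T \<Gamma>)"
proof -
  interpret I: additive_subgroup "tensor_relations T \<Gamma>" "free_rng T \<Gamma>"
    by (rule additive_subgroup_tensor_relations)
  have diff: "r - s \<in> tensor_relations T \<Gamma>"
    if "r \<in> tensor_relations T \<Gamma>" "s \<in> tensor_relations T \<Gamma>" for r s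
    using I.a_closed[OF that(1) I.a_inv_closed[OF that(2)]] I.a_Hcarr[OF that(2)] by simp
  have zero: "0 \<in> tensor_relations T \<Gamma>"
    using I.zero_closed by simp
  \<comment> \<open>\<open>?K\<close> collects the formal sums all of whose products, on either
    side, are relations. It is a subgroup containing the relators, hence contains everything they
    generate.\<close>
  let ?K = "{r \<in> carrier (free_rng T \<Gamma>). \<forall>x\<in>carrier (free_rng T \<Gamma>).
    x \<otimes>\<^bsub>free_rng T \<Gamma>\<^esub> r \<in> tensor_relations T \<Gamma> \<and> r \<otimes>\<^bsub>free_rng T \<Gamma>\<^esub> x \<in> tensor_relations T \<Gamma>}"
  have "additive_subgroup ?K (free_rng T \<Gamma>)"
  proof (rule additive_subgroupI)
    \<comment> \<open>\<open>- r\<close> is treated as \<open>0 - r\<close>, so that distributivity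
      over differences applies.\<close>
    have neg: "- r \<in> ?K" if "r \<in> ?K" for r
      using that diff[OF zero] free_rng_distrib(2)[where p = 0 and p' = r and T = T and \<Gamma> = \<Gamma>]
          free_rng_distrib(4)[where q = 0 and q' = r and T = T and \<Gamma> = \<Gamma>]
      by simp
    have add: "r + s \<in> ?K" if "r \<in> ?K" "s \<in> ?K" for r s
      using that keys_add[of r s] I.a_closed by (auto simp: free_rng_distrib)
    show "subgroup ?K (add_monoid (free_rng T \<Gamma>))"
    proof (rule group.subgroupI[OF free.a_group])
      show "?K \<noteq> {}"
        using zero by (auto intro!: exI[of _ 0])
      fix r assume r: "r \<in> ?K"
      then show "inv\<^bsub>add_monoid (free_rng T \<Gamma>)\<^esub> r \<in> ?K"
        using neg[OF r] a_inv_free_rng[of r T \<Gamma>] unfolding a_inv_def by simp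
    next
      fix r s assume "r \<in> ?K" "s \<in> ?K"
      then show "r \<otimes>\<^bsub>add_monoid (free_rng T \<Gamma>)\<^esub> s \<in> ?K"
        using add by simp
    qed auto
  qed
  moreover have "multilinear_relators T \<Gamma> \<subseteq> ?K"
  proof (intro subsetI CollectI conjI ballI)
    fix r x assume r: "r \<in> multilinear_relators T \<Gamma>"
    show "r \<in> carrier (free_rng T \<Gamma>)"
      using multilinear_relators_carrier[OF r] by simp
    assume "x \<in> carrier (free_rng T \<Gamma>)"
    then have x: "Poly_Mapping.keys x \<subseteq> words T \<Gamma>" by simp
    \<comment> \<open>\<open>x\<close> is built from words by differences, and a word times a
      relator is again a relator.\<close>
    from x show "x \<otimes>\<^bsub>free_rng T \<Gamma>\<^esub> r \<in> tensor_relations T \<Gamma>"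
      by (induction x rule: frag_induction)
        (use r multilinear_relators_word_mult multilinear_relators_subset zero in \<open>auto simp: free_rng_distrib diff\<close>)
    from x show "r \<otimes>\<^bsub>free_rng T \<Gamma>\<^esub> x \<in> tensor_relations T \<Gamma>"
      by (induction x rule: frag_induction)
        (use r multilinear_relators_word_mult multilinear_relators_subset zero in \<open>auto simp: free_rng_distrib diff\<close>)
  qed
  ultimately have "tensor_relations T \<Gamma> \<subseteq> ?K"
    by (rule tensor_relations_minimal)
  then show ?thesis
    unfolding rng_ideal_def using additive_subgroup_tensor_relations by blast
qed

section \<open>The two successive quotients leading to \<open>O_rng T \<Gamma>\<close>\<close>

sublocale rel: rng_quotient "free_rng T \<Gamma>" "tensor_relations T \<Gamma>"
  by unfold_locales (rule rng_ideal_tensor_relations)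

lemma rng_tensor_rng: "rng (tensor_rng T \<Gamma>)"
  unfolding tensor_rng_def by (rule rel.rng_Quot)

sublocale tensor: rng "tensor_rng T \<Gamma>"
  by (rule rng_tensor_rng)

lemma pure_tensor_closed [simp]:
  "\<lbrakk>a \<in> carrier T; \<alpha> \<in> carrier \<Gamma>; b \<in> carrier T; \<beta> \<in> carrier \<Gamma>\<rbrakk>
    \<Longrightarrow> pure_tensor T \<Gamma> a \<alpha> b \<beta> \<in> carrier (tensor_rng T \<Gamma>)"
  by (auto simp: pure_tensor_def tensor_rng_def rel.carrier_Quot words_def)

lemma J_ideal_generator_closed:
  "{pure_tensor T \<Gamma> (tern T a \<alpha> b \<beta> c) \<gamma> d \<delta> \<ominus>\<^bsub>tensor_rng T \<Gamma>\<^esub>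
       pure_tensor T \<Gamma> a \<alpha> (tern T b \<beta> c \<gamma> d) \<delta> | a b c d \<alpha> \<beta> \<gamma> \<delta>.
       a \<in> carrier T \<and> b \<in> carrier T \<and> c \<in> carrier T \<and> d \<in> carrier T \<and>
       \<alpha> \<in> carrier \<Gamma> \<and> \<beta> \<in> carrier \<Gamma> \<and> \<gamma> \<in> carrier \<Gamma> \<and> \<delta> \<in> carrier \<Gamma>} \<subseteq> carrier (tensor_rng T \<Gamma>)"
  by (auto simp: tern_closed)

sublocale J: rng_quotient "tensor_rng T \<Gamma>" "J_ideal T \<Gamma>"
  by unfold_locales
    (unfold J_ideal_def, rule tensor.rng_ideal_genideal[OF J_ideal_generator_closed])

lemma rng_O_rng: "rng (O_rng T \<Gamma>)"
  unfolding O_rng_def by (rule J.rng_Quot)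

sublocale O: rng "O_rng T \<Gamma>"
  by (rule rng_O_rng)

text \<open>The composite of both quotient maps. It is onto and respects both operations, so
  calculations in \<open>O_rng T \<Gamma>\<close> can be done on formal sums.\<close>

definition O_proj :: "(('t, 'g) word \<Rightarrow>\<^sub>0 int) \<Rightarrow> (('t, 'g) word \<Rightarrow>\<^sub>0 int) set set" where
  "O_proj p = J_ideal T \<Gamma> +>\<^bsub>tensor_rng T \<Gamma>\<^esub> (tensor_relations T \<Gamma> +>\<^bsub>free_rng T \<Gamma>\<^esub> p)"

lemma rcos_in_tensor_rng:
  "Poly_Mapping.keys p \<subseteq> words T \<Gamma> \<Longrightarrow>
    tensor_relations T \<Gamma> +>\<^bsub>free_rng T \<Gamma>\<^esub> p \<in> carrier (tensor_rng T \<Gamma>)"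
  by (auto simp: tensor_rng_def rel.carrier_Quot)

lemma O_class_eq: "O_class T \<Gamma> a \<alpha> b \<beta> = O_proj (frag_of (a, \<alpha>, b, \<beta>))"
  by (simp add: O_class_def O_proj_def pure_tensor_def)

lemma carrier_O_rng: "carrier (O_rng T \<Gamma>) = O_proj ` {p. Poly_Mapping.keys p \<subseteq> words T \<Gamma>}"
proof -
  have "carrier (O_rng T \<Gamma>) = (\<lambda>x. J_ideal T \<Gamma> +>\<^bsub>tensor_rng T \<Gamma>\<^esub> x) ` carrier (tensor_rng T \<Gamma>)"
    by (simp only: O_rng_def J.carrier_Quot)
  moreover have "carrier (tensor_rng T \<Gamma>) =
      (\<lambda>p. tensor_relations T \<Gamma> +>\<^bsub>free_rng T \<Gamma>\<^esub> p) ` {p. Poly_Mapping.keys p \<subseteq> words T \<Gamma>}"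
    by (simp only: tensor_rng_def rel.carrier_Quot free_rng_simps)
  ultimately show ?thesis
    by (simp add: O_proj_def[abs_def] image_image)
qed

lemma O_proj_closed [simp]:
  "Poly_Mapping.keys p \<subseteq> words T \<Gamma> \<Longrightarrow> O_proj p \<in> carrier (O_rng T \<Gamma>)"
  by (auto simp: carrier_O_rng)

lemma O_proj_add:
  assumes "Poly_Mapping.keys p \<subseteq> words T \<Gamma>" "Poly_Mapping.keys q \<subseteq> words T \<Gamma>"
  shows "O_proj p \<oplus>\<^bsub>O_rng T \<Gamma>\<^esub> O_proj q = O_proj (p + q)"
  using assms rel.rcos_add[of p q] rcos_in_tensor_rng
  by (simp add: O_proj_def O_rng_def J.rcos_add flip: tensor_rng_def)

lemma O_proj_times:
  assumes "Poly_Mapping.keys p \<subseteq> words T \<Gamma>" "Poly_Mapping.keys q \<subseteq> words T \<Gamma>"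
  shows "O_proj p \<otimes>\<^bsub>O_rng T \<Gamma>\<^esub> O_proj q = O_proj (p \<otimes>\<^bsub>free_rng T \<Gamma>\<^esub> q)"
  using assms rel.rcos_times[of p q] rcos_in_tensor_rng
  by (simp add: O_proj_def O_rng_def J.rcos_times flip: tensor_rng_def)

end

section \<open>The action of \<open>\<O>(T,\<Gamma>)\<close> on a ternary module\<close>

text \<open>The sum is the linear extension of \<open>f\<close>, the homomorphism given by the
  universal property of the free abelian group.\<close>

lemma (in abelian_group) hom_free_Abelian_group_finsum:
  assumes f: "f \<in> S \<rightarrow> carrier G"
  shows "(\<lambda>p. \<Oplus>w\<in>Poly_Mapping.keys p. [Poly_Mapping.lookup p w] \<cdot> f w)
    \<in> hom (free_Abelian_group S) (add_monoid G)"
proof (rule homI)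
  have closed: "(\<lambda>w. [Poly_Mapping.lookup p w] \<cdot> f w) \<in> A \<rightarrow> carrier G" if "A \<subseteq> S" for A and p :: "_ \<Rightarrow>\<^sub>0 int"
    using f that by auto
  \<comment> \<open>Generators outside the support have coefficient 0, so the index set can be
    enlarged to any finite set of generators.\<close>
  have extend: "(\<Oplus>w\<in>Poly_Mapping.keys p. [Poly_Mapping.lookup p w] \<cdot> f w) =
      (\<Oplus>w\<in>A. [Poly_Mapping.lookup p w] \<cdot> f w)"
    if "finite A" "Poly_Mapping.keys p \<subseteq> A" "A \<subseteq> S"
    for A and p :: "_ \<Rightarrow>\<^sub>0 int"
    using that f closed
    by (intro add.finprod_mono_neutral_cong_left) (auto simp: in_keys_iff)
  fix p assume p: "p \<in> carrier (free_Abelian_group S)"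
  then show "(\<Oplus>w\<in>Poly_Mapping.keys p. [Poly_Mapping.lookup p w] \<cdot> f w) \<in> carrier (add_monoid G)"
    using closed by (auto intro!: finsum_closed)
  fix q assume q: "q \<in> carrier (free_Abelian_group S)"
  \<comment> \<open>Cancellation can make the support of \<open>p + q\<close> smaller than this
    union, so all three sums are taken over the union.\<close>
  let ?A = "Poly_Mapping.keys p \<union> Poly_Mapping.keys q"
  have A: "finite ?A" "?A \<subseteq> S" "Poly_Mapping.keys (p + q) \<subseteq> ?A"
    using p q keys_add[of p q] by auto
  have f_closed: "f w \<in> carrier G" if "w \<in> ?A" for w
    using f A(2) that by blast
  have "(\<Oplus>w\<in>?A. [Poly_Mapping.lookup (p + q) w] \<cdot> f w) =
      (\<Oplus>w\<in>?A. [Poly_Mapping.lookup p w] \<cdot> f w \<oplus> [Poly_Mapping.lookup q w] \<cdot> f w)"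
    using f_closed by (intro finsum_cong') (auto simp: lookup_add add.int_pow_mult)
  also have "\<dots> = (\<Oplus>w\<in>?A. [Poly_Mapping.lookup p w] \<cdot> f w) \<oplus> (\<Oplus>w\<in>?A. [Poly_Mapping.lookup q w] \<cdot> f w)"
    using A closed by (intro finsum_addf)
  finally show "(\<Oplus>w\<in>Poly_Mapping.keys (p \<otimes>\<^bsub>free_Abelian_group S\<^esub> q).
        [Poly_Mapping.lookup (p \<otimes>\<^bsub>free_Abelian_group S\<^esub> q) w] \<cdot> f w) =
      (\<Oplus>w\<in>Poly_Mapping.keys p. [Poly_Mapping.lookup p w] \<cdot> f w) \<otimes>\<^bsub>add_monoid G\<^esub>
      (\<Oplus>w\<in>Poly_Mapping.keys q. [Poly_Mapping.lookup q w] \<cdot> f w)"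
    using extend[OF A(1) _ A(2)] A(3) by simp
qed

context ternary_gamma_module
begin

lemma free_act_hom:
  assumes "m \<in> carrier M"
  shows "(\<lambda>p. free_act M p m) \<in> hom (free_Abelian_group (words T \<Gamma>)) (add_monoid M)"
  unfolding free_act_def using assms
  by (intro M.hom_free_Abelian_group_finsum) (auto simp: words_def act_closed)

lemma free_act_frag_of:
  assumes "a \<in> carrier T" "\<alpha> \<in> carrier \<Gamma>" "b \<in> carrier T" "\<beta> \<in> carrier \<Gamma>" "m \<in> carrier M"
  shows "free_act M (frag_of (a, \<alpha>, b, \<beta>)) m = act M a \<alpha> b \<beta> m"
  using assms by (simp add: free_act_def act_closed M.finsum_insert)

lemma
  assumes "m \<in> carrier M" "Poly_Mapping.keys p \<subseteq> words T \<Gamma>"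
  shows free_act_closed: "free_act M p m \<in> carrier M"
    and free_act_minus: "free_act M (- p) m = \<ominus>\<^bsub>M\<^esub> free_act M p m"
    and free_act_add: "Poly_Mapping.keys q \<subseteq> words T \<Gamma> \<Longrightarrow>
      free_act M (p + q) m = free_act M p m \<oplus>\<^bsub>M\<^esub> free_act M q m"
    and free_act_diff: "Poly_Mapping.keys q \<subseteq> words T \<Gamma> \<Longrightarrow>
      free_act M (p - q) m = free_act M p m \<ominus>\<^bsub>M\<^esub> free_act M q m"
proof -
  interpret group_hom "free_Abelian_group (words T \<Gamma>)" "add_monoid M" "\<lambda>p. free_act M p m"
    using free_act_hom[OF assms(1)] M.a_group by (simp add: group_hom_def group_hom_axioms_def)
  show "free_act M p m \<in> carrier M" "free_act M (- p) m = \<ominus>\<^bsub>M\<^esub> free_act M p m"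
    using hom_closed[of p] hom_inv[of p] assms by (simp_all add: a_inv_def)
  show "free_act M (p + q) m = free_act M p m \<oplus>\<^bsub>M\<^esub> free_act M q m" if "Poly_Mapping.keys q \<subseteq> words T \<Gamma>"
    using hom_mult[of p q] assms that by simp
  show "free_act M (p - q) m = free_act M p m \<ominus>\<^bsub>M\<^esub> free_act M q m" if "Poly_Mapping.keys q \<subseteq> words T \<Gamma>"
    using hom_mult[of p "- q"] hom_inv[of q] assms that by (simp add: a_minus_def a_inv_def)
qed

lemma free_act_zero: "m \<in> carrier M \<Longrightarrow> free_act M 0 m = \<zero>\<^bsub>M\<^esub>"
  by (simp add: free_act_def)

text \<open>Both sides are homomorphisms in \<open>p\<close>, and on a single word the claim is
  \<open>act_add5\<close>.\<close>

lemma free_act_r_distr: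
  assumes "m \<in> carrier M" "m' \<in> carrier M" "Poly_Mapping.keys p \<subseteq> words T \<Gamma>"
  shows "free_act M p (m \<oplus>\<^bsub>M\<^esub> m') = free_act M p m \<oplus>\<^bsub>M\<^esub> free_act M p m'"
proof (rule hom_free_Abelian_group_eqI[OF M.a_group free_act_hom _ _ assms(3)])
  show "(\<lambda>p. free_act M p m \<oplus>\<^bsub>M\<^esub> free_act M p m') \<in> hom (free_Abelian_group (words T \<Gamma>)) (add_monoid M)"
    using assms by (intro homI) (auto simp: free_act_closed free_act_add M.a_ac)
qed (use assms in \<open>auto simp: words_def free_act_frag_of act_add5\<close>)

text \<open>For fixed \<open>v\<close> both sides are homomorphisms in \<open>q\<close>; on a word
  the claim is the combination of the two associativity laws.\<close>

lemma free_act_times_word: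
  assumes "m \<in> carrier M" "v \<in> words T \<Gamma>" "Poly_Mapping.keys q \<subseteq> words T \<Gamma>"
  shows "free_act M (frag_of v \<otimes>\<^bsub>free_rng T \<Gamma>\<^esub> q) m = free_act M (frag_of v) (free_act M q m)"
proof (rule hom_free_Abelian_group_eqI[OF M.a_group _ _ _ assms(3)])
  show "(\<lambda>q. free_act M (frag_of v \<otimes>\<^bsub>free_rng T \<Gamma>\<^esub> q) m)
      \<in> hom (free_Abelian_group (words T \<Gamma>)) (add_monoid M)"
    using assms free.times_closed[of "frag_of v"]
    by (intro homI) (auto simp: free_act_closed free_act_add free_rng_distrib)
  show "(\<lambda>q. free_act M (frag_of v) (free_act M q m)) \<in> hom (free_Abelian_group (words T \<Gamma>)) (add_monoid M)"
    using assms by (intro homI) (auto simp: free_act_closed free_act_add free_act_r_distr)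
qed (use assms in \<open>auto simp: words_def word_mult_def free_act_frag_of act_assoc1 act_assoc2 tern_closed act_closed\<close>)

text \<open>Now \<open>q\<close> is fixed and both sides are homomorphisms in \<open>p\<close>; on a
  word \<open>p\<close> this is \<open>free_act_times_word\<close>.\<close>

lemma free_act_times:
  assumes "m \<in> carrier M" "Poly_Mapping.keys p \<subseteq> words T \<Gamma>" "Poly_Mapping.keys q \<subseteq> words T \<Gamma>"
  shows "free_act M (p \<otimes>\<^bsub>free_rng T \<Gamma>\<^esub> q) m = free_act M p (free_act M q m)"
proof (rule hom_free_Abelian_group_eqI[OF M.a_group _ _ _ assms(2)])
  show "(\<lambda>p. free_act M (p \<otimes>\<^bsub>free_rng T \<Gamma>\<^esub> q) m) \<in> hom (free_Abelian_group (words T \<Gamma>)) (add_monoid M)"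
    using assms free.times_closed[of _ q]
    by (intro homI) (auto simp: free_act_closed free_act_add free_rng_distrib)
  show "(\<lambda>p. free_act M p (free_act M q m)) \<in> hom (free_Abelian_group (words T \<Gamma>)) (add_monoid M)"
    using assms by (intro free_act_hom free_act_closed)
qed (use assms in \<open>auto simp: free_act_times_word\<close>)

text \<open>The kernel of the action, taken in the free rng before any quotient, so that the
  relations of both quotients can be compared with it.\<close>

definition annihilator :: "(('t, 'g) word \<Rightarrow>\<^sub>0 int) set" where
  "annihilator = {p. Poly_Mapping.keys p \<subseteq> words T \<Gamma> \<and> (\<forall>m\<in>carrier M. free_act M p m = \<zero>\<^bsub>M\<^esub>)}"

lemma rng_ideal_annihilator: "rng_ideal annihilator (free_rng T \<Gamma>)"
proof (rule rng_idealI)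
  fix a x assume a: "a \<in> annihilator" and x: "x \<in> carrier (free_rng T \<Gamma>)"
  \<comment> \<open>Acting by \<open>x\<close> times \<open>a\<close> means acting by
    \<open>x\<close> on zero, which gives zero by additivity.\<close>
  have "free_act M x \<zero>\<^bsub>M\<^esub> = \<zero>\<^bsub>M\<^esub>"
    using x free_act_r_distr[of "\<zero>\<^bsub>M\<^esub>" "\<zero>\<^bsub>M\<^esub>" x] by (simp add: free_act_closed)
  then show "x \<otimes>\<^bsub>free_rng T \<Gamma>\<^esub> a \<in> annihilator" "a \<otimes>\<^bsub>free_rng T \<Gamma>\<^esub> x \<in> annihilator"
    using a x free.times_closed[of a x] free.times_closed[of x a]
    by (auto simp: annihilator_def free_act_times free_act_closed)
next
  fix x y assume "x \<in> annihilator" "y \<in> annihilator"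
  then show "x \<oplus>\<^bsub>free_rng T \<Gamma>\<^esub> y \<in> annihilator"
    using keys_add[of x y] by (auto simp: annihilator_def free_act_add)
qed (auto simp: annihilator_def free_act_minus free_act_zero abelian_group_free_rng)

sublocale ann: rng_quotient "free_rng T \<Gamma>" annihilator
  by unfold_locales (rule rng_ideal_annihilator)

lemma annihilator_diffI:
  assumes "v \<in> words T \<Gamma>" "w \<in> words T \<Gamma>"
    and "\<And>m. m \<in> carrier M \<Longrightarrow> free_act M (frag_of v) m = free_act M (frag_of w) m"
  shows "frag_of v - frag_of w \<in> annihilator"
  using assms keys_diff[of "frag_of v" "frag_of w"]
  by (auto simp: annihilator_def free_act_diff free_act_closed M.minus_eq M.r_neg)

text \<open>The annihilator is a subgroup, so it suffices to treat relators; each is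
  \<open>u - v - w\<close> for words with \<open>u\<close> acting as the sum of \<open>v\<close> and
  \<open>w\<close>.\<close>

lemma tensor_relations_annihilator: "tensor_relations T \<Gamma> \<subseteq> annihilator"
proof (intro tensor_relations_minimal ann.is_additive_subgroup subsetI)
  fix r assume r: "r \<in> multilinear_relators T \<Gamma>"
  have *: "frag_of u - frag_of v - frag_of w \<in> annihilator"
    if "u \<in> words T \<Gamma>" "v \<in> words T \<Gamma>" "w \<in> words T \<Gamma>"
      and eq: "\<And>m. m \<in> carrier M \<Longrightarrow>
        free_act M (frag_of u) m = free_act M (frag_of v) m \<oplus>\<^bsub>M\<^esub> free_act M (frag_of w) m"
    for u v w
  proof -
    have vw: "Poly_Mapping.keys (frag_of v + frag_of w) \<subseteq> words T \<Gamma>"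
      using that keys_add[of "frag_of v" "frag_of w"] by auto
    have "free_act M (frag_of u - (frag_of v + frag_of w)) m = \<zero>\<^bsub>M\<^esub>" if "m \<in> carrier M" for m
      using that vw \<open>u \<in> _\<close> \<open>v \<in> _\<close> \<open>w \<in> _\<close> eq[OF that]
      by (simp add: free_act_diff free_act_add free_act_closed M.minus_eq M.r_neg)
    then show ?thesis
      using \<open>u \<in> _\<close> vw keys_diff[of "frag_of u" "frag_of v + frag_of w"]
      by (auto simp: annihilator_def diff_diff_eq)
  qed
  from r show "r \<in> annihilator"
    by (cases rule: multilinear_relatorsE)
      (simp_all add: * words_def free_act_frag_of act_add1 act_add2 act_add3 act_add4)
qed

text \<open>The image of the annihilator is again an ideal, so it suffices to place the generators
  of \<open>J_ideal T \<Gamma>\<close> in it, which is \<open>act_assoc1\<close>.\<close>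

lemma J_ideal_annihilator:
  "J_ideal T \<Gamma> \<subseteq> (\<lambda>p. tensor_relations T \<Gamma> +>\<^bsub>free_rng T \<Gamma>\<^esub> p) ` annihilator"
  unfolding J_ideal_def
proof (rule rng_genideal_minimal)
  show "rng_ideal ((\<lambda>p. tensor_relations T \<Gamma> +>\<^bsub>free_rng T \<Gamma>\<^esub> p) ` annihilator) (tensor_rng T \<Gamma>)"
    unfolding tensor_rng_def by (rule rel.rng_ideal_rcos_image[OF rng_ideal_annihilator])
  have diff: "(tensor_relations T \<Gamma> +>\<^bsub>free_rng T \<Gamma>\<^esub> p) \<ominus>\<^bsub>tensor_rng T \<Gamma>\<^esub> (tensor_relations T \<Gamma> +>\<^bsub>free_rng T \<Gamma>\<^esub> q)
      = tensor_relations T \<Gamma> +>\<^bsub>free_rng T \<Gamma>\<^esub> (p - q)"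
    if "Poly_Mapping.keys p \<subseteq> words T \<Gamma>" "Poly_Mapping.keys q \<subseteq> words T \<Gamma>" for p q
    using that rel.rcos_a_inv[of q] rel.rcos_add[of p "- q"] by (simp add: a_minus_def tensor_rng_def)
  show "{pure_tensor T \<Gamma> (tern T a \<alpha> b \<beta> c) \<gamma> d \<delta> \<ominus>\<^bsub>tensor_rng T \<Gamma>\<^esub>
       pure_tensor T \<Gamma> a \<alpha> (tern T b \<beta> c \<gamma> d) \<delta> | a b c d \<alpha> \<beta> \<gamma> \<delta>.
       a \<in> carrier T \<and> b \<in> carrier T \<and> c \<in> carrier T \<and> d \<in> carrier T \<and>
       \<alpha> \<in> carrier \<Gamma> \<and> \<beta> \<in> carrier \<Gamma> \<and> \<gamma> \<in> carrier \<Gamma> \<and> \<delta> \<in> carrier \<Gamma>}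
      \<subseteq> (\<lambda>p. tensor_relations T \<Gamma> +>\<^bsub>free_rng T \<Gamma>\<^esub> p) ` annihilator"
    by (auto simp: pure_tensor_def diff words_def tern_closed free_act_frag_of act_assoc1
        intro!: imageI annihilator_diffI)
qed

text \<open>\<open>O_act\<close> is defined by \<open>the_elem\<close>, so all representatives must
  act alike: each differs from \<open>p\<close> by a tensor relation plus an annihilating
  representative of an element of \<open>J_ideal T \<Gamma>\<close>.\<close>

lemma O_act_O_proj:
  assumes m: "m \<in> carrier M" and p: "Poly_Mapping.keys p \<subseteq> words T \<Gamma>"
  shows "O_act M (O_proj p) m = free_act M p m"
proof -
  have "free_act M q m = free_act M p m" if "q \<in> \<Union>(O_proj p)" for q
  proof -
    from that obtain j where j: "j \<in> J_ideal T \<Gamma>"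
      and q: "q \<in> j \<oplus>\<^bsub>tensor_rng T \<Gamma>\<^esub> (tensor_relations T \<Gamma> +>\<^bsub>free_rng T \<Gamma>\<^esub> p)"
      by (auto simp: O_proj_def a_r_coset_def')
    from j J_ideal_annihilator obtain k where k: "k \<in> annihilator"
      "j = tensor_relations T \<Gamma> +>\<^bsub>free_rng T \<Gamma>\<^esub> k" by blast
    have "j \<oplus>\<^bsub>tensor_rng T \<Gamma>\<^esub> (tensor_relations T \<Gamma> +>\<^bsub>free_rng T \<Gamma>\<^esub> p)
        = tensor_relations T \<Gamma> +>\<^bsub>free_rng T \<Gamma>\<^esub> (k + p)"
      using k p rel.rcos_add[of k p] ann.a_Hcarr[of k] by (simp add: tensor_rng_def)
    with q obtain h where h: "h \<in> tensor_relations T \<Gamma>" "q = h + (k + p)"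
      by (auto simp: a_r_coset_def')
    \<comment> \<open>Both corrections act as zero: \<open>h\<close> as a tensor relation,
      \<open>k\<close> by its choice.\<close>
    have "h + k \<in> annihilator"
      using ann.a_closed[of h k] h k tensor_relations_annihilator by auto
    moreover have "q = (h + k) + p"
      using h by (simp add: add.assoc)
    ultimately show ?thesis
      using m p by (simp add: free_act_add annihilator_def free_act_closed)
  qed
  \<comment> \<open>The image has to be nonempty as well in order to be a singleton.\<close>
  moreover have "p \<in> \<Union>(O_proj p)"
    using rel.a_rcos_self[of p] J.a_rcos_self[OF rcos_in_tensor_rng[OF p]] p
    by (auto simp: O_proj_def)
  ultimately have "(\<lambda>q. free_act M q m) ` \<Union>(O_proj p) = {free_act M p m}"
    by blast
  then show ?thesis
    by (simp add: O_act_def)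
qed

lemma rng_action_O_act: "rng_action (O_rng T \<Gamma>) M (O_act M)"
proof (intro rng_action.intro rng_action_axioms.intro rng_O_rng M.abelian_group_axioms)
  fix r s m assume "r \<in> carrier (O_rng T \<Gamma>)" "s \<in> carrier (O_rng T \<Gamma>)" "m \<in> carrier M"
  moreover from this obtain p q where "Poly_Mapping.keys p \<subseteq> words T \<Gamma>" "Poly_Mapping.keys q \<subseteq> words T \<Gamma>"
    "r = O_proj p" "s = O_proj q"
    by (auto simp: carrier_O_rng)
  ultimately show "O_act M (r \<oplus>\<^bsub>O_rng T \<Gamma>\<^esub> s) m = O_act M r m \<oplus>\<^bsub>M\<^esub> O_act M s m"
    "O_act M (r \<otimes>\<^bsub>O_rng T \<Gamma>\<^esub> s) m = O_act M r (O_act M s m)"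
    using order_trans[OF keys_add[of p q] Un_least] free.times_closed[of p q]
    by (auto simp: O_proj_add O_proj_times O_act_O_proj free_act_add free_act_times free_act_closed)
qed (auto simp: carrier_O_rng O_act_O_proj free_act_closed free_act_r_distr)

end

section \<open>The two constructions on objects\<close>

text \<open>The two kinds of module are records of different types, so facts about their common
  additive group are moved between them field by field.\<close>

lemma abelian_group_cong:
  assumes "abelian_group M" "carrier N = carrier M" "add N = add M" "ring.zero N = ring.zero M"
  shows "abelian_group N"
  using abelian_groupE[OF assms(1)] assms(2-) by (intro abelian_groupI) auto

text \<open>Negative multiples involve inverses, which are chosen within the carrier; hence the
  carriers have to agree too.\<close>

lemma add_pow_int_cong:
  assumes "carrier N = carrier M" "add N = add M" "ring.zero N = ring.zero M"
  shows "[(n::int)] \<cdot>\<^bsub>N\<^esub> x = [n] \<cdot>\<^bsub>M\<^esub> x"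
  using assms by (simp add: add_pow_def int_pow_def nat_pow_def m_inv_def Let_def)

text \<open>Converse of \<open>left_module_dorrohI\<close>: \<open>r\<close> acts as
  \<open>(0, r)\<close>, and \<open>(n, r)\<close> splits as \<open>(n, \<zero>)\<close> plus
  \<open>(0, r)\<close>.\<close>

lemma left_module_dorrohD:
  assumes "rng R" "left_module (dorroh R) M"
  shows "rng_action R M (\<lambda>r m. (0, r) \<odot>\<^bsub>M\<^esub> m)"
    and "\<lbrakk>r \<in> carrier R; m \<in> carrier M\<rbrakk> \<Longrightarrow>
      (n, r) \<odot>\<^bsub>M\<^esub> m = [n] \<cdot>\<^bsub>M\<^esub> m \<oplus>\<^bsub>M\<^esub> (0, r) \<odot>\<^bsub>M\<^esub> m"
proof -
  interpret rng R by fact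
  interpret M: left_module "dorroh R" M by fact
  have carr: "(n, r) \<in> carrier (dorroh R) \<longleftrightarrow> r \<in> carrier R" for n r
    by (simp add: dorroh_def)
  have add: "(n, r) \<oplus>\<^bsub>dorroh R\<^esub> (k, s) = (n + k, r \<oplus>\<^bsub>R\<^esub> s)" for n k r s
    by (simp add: dorroh_def)
  have times: "(0, r) \<otimes>\<^bsub>dorroh R\<^esub> (0, s) = (0, r \<otimes>\<^bsub>R\<^esub> s)" if "r \<in> carrier R" "s \<in> carrier R" for r s
    using that by (simp add: dorroh_def)
  show "rng_action R M (\<lambda>r m. (0, r) \<odot>\<^bsub>M\<^esub> m)"
  proof (intro rng_action.intro rng_action_axioms.intro rng_axioms M.M.abelian_group_axioms)
    fix r s m assume "r \<in> carrier R" "s \<in> carrier R" "m \<in> carrier M"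
    then show "(0, r \<oplus>\<^bsub>R\<^esub> s) \<odot>\<^bsub>M\<^esub> m = (0, r) \<odot>\<^bsub>M\<^esub> m \<oplus>\<^bsub>M\<^esub> (0, s) \<odot>\<^bsub>M\<^esub> m"
      "(0, r \<otimes>\<^bsub>R\<^esub> s) \<odot>\<^bsub>M\<^esub> m = (0, r) \<odot>\<^bsub>M\<^esub> ((0, s) \<odot>\<^bsub>M\<^esub> m)"
      using M.smult_l_distr[of "(0, r)" "(0, s)" m] M.smult_assoc1[of "(0, r)" "(0, s)" m]
      by (simp_all add: carr add times)
  qed (simp_all add: carr M.smult_closed M.smult_r_distr)
  assume r: "r \<in> carrier R" and m: "m \<in> carrier M"
  \<comment> \<open>The action of \<open>(n, \<zero>)\<close> is additive in \<open>n\<close>, which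
    reduces it to the identity \<open>(1, \<zero>)\<close> of the Dorroh extension.\<close>
  have "(n, \<zero>\<^bsub>R\<^esub>) \<odot>\<^bsub>M\<^esub> m = [n] \<cdot>\<^bsub>M\<^esub> ((1, \<zero>\<^bsub>R\<^esub>) \<odot>\<^bsub>M\<^esub> m)"
  proof (rule M.M.eq_add_pow_int)
    show "(k, \<zero>\<^bsub>R\<^esub>) \<odot>\<^bsub>M\<^esub> m \<in> carrier M" for k
      using m by (simp add: carr M.smult_closed)
    show "(k + l, \<zero>\<^bsub>R\<^esub>) \<odot>\<^bsub>M\<^esub> m = (k, \<zero>\<^bsub>R\<^esub>) \<odot>\<^bsub>M\<^esub> m \<oplus>\<^bsub>M\<^esub> (l, \<zero>\<^bsub>R\<^esub>) \<odot>\<^bsub>M\<^esub> m" for k l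
      using m M.smult_l_distr[of "(k, \<zero>\<^bsub>R\<^esub>)" "(l, \<zero>\<^bsub>R\<^esub>)" m] by (simp add: carr add)
  qed
  moreover have "(1, \<zero>\<^bsub>R\<^esub>) \<odot>\<^bsub>M\<^esub> m = m"
    using M.smult_one[OF m] by (simp add: dorroh_def)
  ultimately show "(n, r) \<odot>\<^bsub>M\<^esub> m = [n] \<cdot>\<^bsub>M\<^esub> m \<oplus>\<^bsub>M\<^esub> (0, r) \<odot>\<^bsub>M\<^esub> m"
    using r m M.smult_l_distr[of "(n, \<zero>\<^bsub>R\<^esub>)" "(0, r)" m] by (simp add: carr add)
qed

lemma to_A_module_simps [simp]:
  "carrier (to_A_module M) = carrier M"
  "add (to_A_module M) = add M"
  "ring.zero (to_A_module M) = ring.zero M"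
  "(n, r) \<odot>\<^bsub>to_A_module M\<^esub> m = [n] \<cdot>\<^bsub>M\<^esub> m \<oplus>\<^bsub>M\<^esub> O_act M r m"
  by (simp_all add: to_A_module_def)

lemma to_TGamma_module_simps [simp]:
  "carrier (to_TGamma_module T \<Gamma> N) = carrier N"
  "add (to_TGamma_module T \<Gamma> N) = add N"
  "ring.zero (to_TGamma_module T \<Gamma> N) = ring.zero N"
  "act (to_TGamma_module T \<Gamma> N) a \<alpha> b \<beta> m = (0, O_class T \<Gamma> a \<alpha> b \<beta>) \<odot>\<^bsub>N\<^esub> m"
  by (simp_all add: to_TGamma_module_def)

text \<open>A rng action sees only the additive group, which \<open>to_A_module\<close> keeps, so
  \<open>O_act M\<close> also acts on the new record; its scalar multiplication has the form
  required by \<open>left_module_dorrohI\<close>.\<close>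

lemma (in ternary_gamma_module) left_module_to_A_module:
  "left_module (A_ring T \<Gamma>) (to_A_module M)"
  unfolding A_ring_def
proof (rule left_module_dorrohI)
  interpret act: rng_action "O_rng T \<Gamma>" M "O_act M" by (rule rng_action_O_act)
  show "rng_action (O_rng T \<Gamma>) (to_A_module M) (O_act M)"
    by (intro rng_action.intro rng_action_axioms.intro rng_O_rng abelian_group_cong[OF M.abelian_group_axioms])
      (simp_all add: act.ract_l_distr act.ract_r_distr act.ract_assoc)
qed (simp add: add_pow_int_cong[of "to_A_module M" M])

section \<open>Classes of pure tensors, and the round trips on objects\<close>

context ternary_gamma_ring
begin

lemma O_proj_eqI:
  assumes "p - q \<in> tensor_relations T \<Gamma>" "Poly_Mapping.keys q \<subseteq> words T \<Gamma>"
  shows "O_proj p = O_proj q"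
proof -
  have "p \<in> tensor_relations T \<Gamma> +>\<^bsub>free_rng T \<Gamma>\<^esub> q"
    using assms(1) by (force simp: a_r_coset_def')
  then show ?thesis
    using rel.a_repr_independence'[of p q] assms(2) by (simp add: O_proj_def)
qed

text \<open>A relator vanishes already in the first quotient.\<close>

lemma O_proj_relator:
  assumes "frag_of u - frag_of v - frag_of w \<in> multilinear_relators T \<Gamma>" "v \<in> words T \<Gamma>" "w \<in> words T \<Gamma>"
  shows "O_proj (frag_of u) = O_proj (frag_of v) \<oplus>\<^bsub>O_rng T \<Gamma>\<^esub> O_proj (frag_of w)"
  using assms multilinear_relators_subset O_proj_eqI[of "frag_of u" "frag_of v + frag_of w"]
    order_trans[OF keys_add[of "frag_of v" "frag_of w"] Un_least]
  by (auto simp: O_proj_add diff_diff_eq)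

lemma O_class_closed [simp]:
  "\<lbrakk>a \<in> carrier T; \<alpha> \<in> carrier \<Gamma>; b \<in> carrier T; \<beta> \<in> carrier \<Gamma>\<rbrakk>
    \<Longrightarrow> O_class T \<Gamma> a \<alpha> b \<beta> \<in> carrier (O_rng T \<Gamma>)"
  by (simp add: O_class_eq words_def)

lemma O_class_add:
  "\<lbrakk>a \<in> carrier T; a' \<in> carrier T; \<alpha> \<in> carrier \<Gamma>; b \<in> carrier T; \<beta> \<in> carrier \<Gamma>\<rbrakk> \<Longrightarrow>
    O_class T \<Gamma> (a \<oplus>\<^bsub>T\<^esub> a') \<alpha> b \<beta> = O_class T \<Gamma> a \<alpha> b \<beta> \<oplus>\<^bsub>O_rng T \<Gamma>\<^esub> O_class T \<Gamma> a' \<alpha> b \<beta>"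
  "\<lbrakk>a \<in> carrier T; \<alpha> \<in> carrier \<Gamma>; \<alpha>' \<in> carrier \<Gamma>; b \<in> carrier T; \<beta> \<in> carrier \<Gamma>\<rbrakk> \<Longrightarrow>
    O_class T \<Gamma> a (\<alpha> \<oplus>\<^bsub>\<Gamma>\<^esub> \<alpha>') b \<beta> = O_class T \<Gamma> a \<alpha> b \<beta> \<oplus>\<^bsub>O_rng T \<Gamma>\<^esub> O_class T \<Gamma> a \<alpha>' b \<beta>"
  "\<lbrakk>a \<in> carrier T; \<alpha> \<in> carrier \<Gamma>; b \<in> carrier T; b' \<in> carrier T; \<beta> \<in> carrier \<Gamma>\<rbrakk> \<Longrightarrow>
    O_class T \<Gamma> a \<alpha> (b \<oplus>\<^bsub>T\<^esub> b') \<beta> = O_class T \<Gamma> a \<alpha> b \<beta> \<oplus>\<^bsub>O_rng T \<Gamma>\<^esub> O_class T \<Gamma> a \<alpha> b' \<beta>"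
  "\<lbrakk>a \<in> carrier T; \<alpha> \<in> carrier \<Gamma>; b \<in> carrier T; \<beta> \<in> carrier \<Gamma>; \<beta>' \<in> carrier \<Gamma>\<rbrakk> \<Longrightarrow>
    O_class T \<Gamma> a \<alpha> b (\<beta> \<oplus>\<^bsub>\<Gamma>\<^esub> \<beta>') = O_class T \<Gamma> a \<alpha> b \<beta> \<oplus>\<^bsub>O_rng T \<Gamma>\<^esub> O_class T \<Gamma> a \<alpha> b \<beta>'"
  unfolding O_class_eq by (rule O_proj_relator; simp add: words_def multilinear_relatorsI)+

lemma O_class_times:
  "\<lbrakk>a \<in> carrier T; \<alpha> \<in> carrier \<Gamma>; b \<in> carrier T; \<beta> \<in> carrier \<Gamma>;
    c \<in> carrier T; \<gamma> \<in> carrier \<Gamma>; d \<in> carrier T; \<delta> \<in> carrier \<Gamma>\<rbrakk> \<Longrightarrow>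
    O_class T \<Gamma> a \<alpha> b \<beta> \<otimes>\<^bsub>O_rng T \<Gamma>\<^esub> O_class T \<Gamma> c \<gamma> d \<delta> = O_class T \<Gamma> (tern T a \<alpha> b \<beta> c) \<gamma> d \<delta>"
  by (simp add: O_class_eq O_proj_times words_def word_mult_def)

text \<open>The difference of the two pure tensors is a generator of
  \<open>J_ideal T \<Gamma>\<close>.\<close>

lemma O_class_tern:
  assumes "a \<in> carrier T" "\<alpha> \<in> carrier \<Gamma>" "b \<in> carrier T" "\<beta> \<in> carrier \<Gamma>"
    "c \<in> carrier T" "\<gamma> \<in> carrier \<Gamma>" "d \<in> carrier T" "\<delta> \<in> carrier \<Gamma>"
  shows "O_class T \<Gamma> (tern T a \<alpha> b \<beta> c) \<gamma> d \<delta> = O_class T \<Gamma> a \<alpha> (tern T b \<beta> c \<gamma> d) \<delta>"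
proof -
  let ?x = "pure_tensor T \<Gamma> (tern T a \<alpha> b \<beta> c) \<gamma> d \<delta>"
  let ?y = "pure_tensor T \<Gamma> a \<alpha> (tern T b \<beta> c \<gamma> d) \<delta>"
  have "?x \<ominus>\<^bsub>tensor_rng T \<Gamma>\<^esub> ?y \<in> J_ideal T \<Gamma>"
    unfolding J_ideal_def using assms by (intro subsetD[OF rng_genideal_superset]) blast
  then have "?x \<in> J_ideal T \<Gamma> +>\<^bsub>tensor_rng T \<Gamma>\<^esub> ?y"
    using assms by (simp add: J.a_rcos_module tensor.minus_eq tern_closed)
  then show ?thesis
    using assms J.a_repr_independence'[of ?x ?y] by (simp add: O_class_def tern_closed)
qed

text \<open>Read backwards, \<open>N.ract_assoc\<close> turns an iterated action into the action of
  a product; \<open>O_class_times\<close> and \<open>O_class_tern\<close> then give both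
  associativity laws.\<close>

lemma ternary_gamma_module_to_TGamma_module:
  assumes "left_module (A_ring T \<Gamma>) N"
  shows "ternary_gamma_module T \<Gamma> (to_TGamma_module T \<Gamma> N)"
proof -
  interpret N: rng_action "O_rng T \<Gamma>" N "\<lambda>r m. (0, r) \<odot>\<^bsub>N\<^esub> m"
    using left_module_dorrohD(1)[OF rng_O_rng] assms by (simp add: A_ring_def)
  show ?thesis
    by (intro ternary_gamma_module.intro ternary_gamma_module_axioms.intro ternary_gamma_ring_axioms
        abelian_group_cong[OF N.M.abelian_group_axioms])
      (simp_all add: O_class_add N.ract_l_distr N.ract_r_distr O_class_times tern_closed O_class_tern
        flip: N.ract_assoc)
qed

text \<open>As functions of a formal sum representing \<open>r\<close>, both sides are
  homomorphisms; on a word they agree by the definition of the ternary action.\<close>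

lemma O_act_to_TGamma_module:
  assumes "left_module (A_ring T \<Gamma>) N" "r \<in> carrier (O_rng T \<Gamma>)" "m \<in> carrier N"
  shows "O_act (to_TGamma_module T \<Gamma> N) r m = (0, r) \<odot>\<^bsub>N\<^esub> m"
proof -
  interpret M: ternary_gamma_module T \<Gamma> "to_TGamma_module T \<Gamma> N"
    using assms(1) by (rule ternary_gamma_module_to_TGamma_module)
  interpret N: rng_action "O_rng T \<Gamma>" N "\<lambda>r m. (0, r) \<odot>\<^bsub>N\<^esub> m"
    using left_module_dorrohD(1)[OF rng_O_rng] assms by (simp add: A_ring_def)
  from assms obtain p where p: "Poly_Mapping.keys p \<subseteq> words T \<Gamma>" "r = O_proj p"
    by (auto simp: carrier_O_rng)
  have "free_act (to_TGamma_module T \<Gamma> N) p m = (0, O_proj p) \<odot>\<^bsub>N\<^esub> m"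
  proof (rule hom_free_Abelian_group_eqI[OF M.M.a_group M.free_act_hom _ _ p(1)])
    show "(\<lambda>p. (0, O_proj p) \<odot>\<^bsub>N\<^esub> m) \<in>
        hom (free_Abelian_group (words T \<Gamma>)) (add_monoid (to_TGamma_module T \<Gamma> N))"
      using assms by (intro homI) (auto simp: N.ract_l_distr simp flip: O_proj_add)
  qed (use assms in \<open>auto simp: words_def M.free_act_frag_of O_class_eq\<close>)
  then show ?thesis
    using p assms by (simp add: M.O_act_O_proj)
qed

lemma smult_to_A_module_to_TGamma_module:
  assumes "left_module (A_ring T \<Gamma>) N" "x \<in> carrier (A_ring T \<Gamma>)" "m \<in> carrier N"
  shows "x \<odot>\<^bsub>to_A_module (to_TGamma_module T \<Gamma> N)\<^esub> m = x \<odot>\<^bsub>N\<^esub> m"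
  using assms left_module_dorrohD(2)[OF rng_O_rng, of N "snd x" m "fst x"]
  by (cases x) (simp add: O_act_to_TGamma_module A_ring_def dorroh_def
      add_pow_int_cong[of "to_TGamma_module T \<Gamma> N" N])

end

lemma (in ternary_gamma_module) act_to_TGamma_module_to_A_module:
  assumes "a \<in> carrier T" "\<alpha> \<in> carrier \<Gamma>" "b \<in> carrier T" "\<beta> \<in> carrier \<Gamma>" "m \<in> carrier M"
  shows "act (to_TGamma_module T \<Gamma> (to_A_module M)) a \<alpha> b \<beta> m = act M a \<alpha> b \<beta> m"
  using assms by (simp add: O_class_eq O_act_O_proj words_def free_act_frag_of act_closed)

section \<open>The equivalence of categories\<close>

lemma category_TGammaMod: "category (TGammaMod T \<Gamma>)"
proof
  fix M assume "M \<in> Ob (TGammaMod T \<Gamma>)"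
  then interpret ternary_gamma_module T \<Gamma> M by (simp add: TGammaMod_def)
  show "Ident (TGammaMod T \<Gamma>) M \<in> Hom (TGammaMod T \<Gamma>) M M"
    by (auto simp: TGammaMod_def tgamma_hom_def act_closed)
next
  fix L M N f g
  assume "L \<in> Ob (TGammaMod T \<Gamma>)"
    and fg: "f \<in> Hom (TGammaMod T \<Gamma>) L M" "g \<in> Hom (TGammaMod T \<Gamma>) M N"
  \<comment> \<open>The composite is restricted to the carrier of \<open>L\<close>, so evaluating it
    at sums and at values of the action requires closure in \<open>L\<close>.\<close>
  then interpret ternary_gamma_module T \<Gamma> L by (simp add: TGammaMod_def)
  show "Comp (TGammaMod T \<Gamma>) L M N g f \<in> Hom (TGammaMod T \<Gamma>) L N"
    using fg by (auto simp: TGammaMod_def tgamma_hom_def compose_def act_closed PiE_def Pi_iff)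
\<comment> \<open>The unit and associativity laws hold as equalities of functions because morphisms
  are \<open>undefined\<close> off the carrier.\<close>
qed (auto simp: TGammaMod_def tgamma_hom_def compose_def fun_eq_iff PiE_def Pi_iff extensional_def)

lemma category_LeftMod: "category (LeftMod R)"
proof
  fix M assume "M \<in> Ob (LeftMod R)"
  then interpret left_module R M by (simp add: LeftMod_def)
  show "Ident (LeftMod R) M \<in> Hom (LeftMod R) M M"
    by (auto simp: LeftMod_def left_module_hom_def smult_closed)
next
  fix L M N f g
  assume "L \<in> Ob (LeftMod R)"
    and fg: "f \<in> Hom (LeftMod R) L M" "g \<in> Hom (LeftMod R) M N"
  then interpret left_module R L by (simp add: LeftMod_def)
  show "Comp (LeftMod R) L M N g f \<in> Hom (LeftMod R) L N"
    using fg by (auto simp: LeftMod_def left_module_hom_def compose_def smult_closed PiE_def Pi_iff)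
qed (auto simp: LeftMod_def left_module_hom_def compose_def fun_eq_iff PiE_def Pi_iff extensional_def)

text \<open>Both sides are homomorphisms in \<open>p\<close>, and on a word the claim is that
  \<open>f\<close> preserves the ternary action.\<close>

lemma tgamma_hom_free_act:
  assumes "ternary_gamma_module T \<Gamma> M" "ternary_gamma_module T \<Gamma> N" "f \<in> tgamma_hom T \<Gamma> M N"
    and m: "m \<in> carrier M" and p: "Poly_Mapping.keys p \<subseteq> words T \<Gamma>"
  shows "f (free_act M p m) = free_act N p (f m)"
proof -
  interpret M: ternary_gamma_module T \<Gamma> M by fact
  interpret N: ternary_gamma_module T \<Gamma> N by fact
  have f: "f x \<in> carrier N" "f (x \<oplus>\<^bsub>M\<^esub> y) = f x \<oplus>\<^bsub>N\<^esub> f y"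
    "\<lbrakk>a \<in> carrier T; \<alpha> \<in> carrier \<Gamma>; b \<in> carrier T; \<beta> \<in> carrier \<Gamma>\<rbrakk>
      \<Longrightarrow> f (act M a \<alpha> b \<beta> x) = act N a \<alpha> b \<beta> (f x)"
    if "x \<in> carrier M" "y \<in> carrier M" for x y a \<alpha> b \<beta>
    using assms(3) that by (auto simp: tgamma_hom_def)
  show ?thesis
  proof (rule hom_free_Abelian_group_eqI[OF N.M.a_group _ N.free_act_hom _ p])
    show "(\<lambda>p. f (free_act M p m)) \<in> hom (free_Abelian_group (words T \<Gamma>)) (add_monoid N)"
      using m by (intro homI) (auto simp: f M.free_act_closed M.free_act_add)
  qed (use f m in \<open>auto simp: words_def M.free_act_frag_of N.free_act_frag_of\<close>)
qed

lemma tgamma_hom_imp_left_module_hom: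
  assumes "ternary_gamma_module T \<Gamma> M" "ternary_gamma_module T \<Gamma> N" "f \<in> tgamma_hom T \<Gamma> M N"
  shows "f \<in> left_module_hom (A_ring T \<Gamma>) (to_A_module M) (to_A_module N)"
proof -
  interpret M: ternary_gamma_module T \<Gamma> M by fact
  interpret N: ternary_gamma_module T \<Gamma> N by fact
  have f: "f \<in> hom (add_monoid M) (add_monoid N)"
    using assms(3) by (auto simp: tgamma_hom_def intro!: homI)
  have pow: "f ([(n::int)] \<cdot>\<^bsub>M\<^esub> m) = [n] \<cdot>\<^bsub>N\<^esub> f m" if "m \<in> carrier M" for n m
    using hom_int_pow[OF f _ M.M.a_group N.M.a_group, of m n] that by (simp add: add_pow_def)
  have "f (x \<odot>\<^bsub>to_A_module M\<^esub> m) = x \<odot>\<^bsub>to_A_module N\<^esub> f m"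
    if x: "x \<in> carrier (A_ring T \<Gamma>)" and m: "m \<in> carrier M" for x m
  proof -
    \<comment> \<open>\<open>O_proj\<close> depends only on \<open>T\<close> and
      \<open>\<Gamma>\<close>, so one formal sum \<open>p\<close> computes the action on both
      modules.\<close>
    obtain n p where "x = (n, M.O_proj p)" and p: "Poly_Mapping.keys p \<subseteq> words T \<Gamma>"
      using x by (auto simp: A_ring_def dorroh_def M.carrier_O_rng)
    moreover have "f m \<in> carrier N"
      using hom_in_carrier[OF f] m by simp
    ultimately show ?thesis
      using m assms hom_mult[OF f, of "[n] \<cdot>\<^bsub>M\<^esub> m" "free_act M p m"]
      by (simp add: M.O_act_O_proj N.O_act_O_proj M.free_act_closed pow tgamma_hom_free_act)
  qed
  then show ?thesis
    using assms(3) by (simp add: left_module_hom_def tgamma_hom_def)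
qed

text \<open>The ternary actions are scalar multiplications by the particular elements
  \<open>(0, O_class T \<Gamma> a \<alpha> b \<beta>)\<close>.\<close>

lemma (in ternary_gamma_ring) left_module_hom_imp_tgamma_hom:
  assumes "f \<in> left_module_hom (A_ring T \<Gamma>) M N"
  shows "f \<in> tgamma_hom T \<Gamma> (to_TGamma_module T \<Gamma> M) (to_TGamma_module T \<Gamma> N)"
  using assms by (auto simp: left_module_hom_def tgamma_hom_def A_ring_def dorroh_def)

text \<open>Applied to a module and its round trip, the two memberships provide the unit component
  and its inverse.\<close>

lemma tgamma_hom_ident:
  assumes "ternary_gamma_module T \<Gamma> M" "carrier N = carrier M" "add N = add M"
    and "\<And>a \<alpha> b \<beta> m. \<lbrakk>a \<in> carrier T; \<alpha> \<in> carrier \<Gamma>; b \<in> carrier T; \<beta> \<in> carrier \<Gamma>; m \<in> carrier M\<rbrakk>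
      \<Longrightarrow> act N a \<alpha> b \<beta> m = act M a \<alpha> b \<beta> m"
  shows "(\<lambda>m\<in>carrier M. m) \<in> tgamma_hom T \<Gamma> M N" "(\<lambda>m\<in>carrier M. m) \<in> tgamma_hom T \<Gamma> N M"
proof -
  interpret ternary_gamma_module T \<Gamma> M by fact
  show "(\<lambda>m\<in>carrier M. m) \<in> tgamma_hom T \<Gamma> M N" "(\<lambda>m\<in>carrier M. m) \<in> tgamma_hom T \<Gamma> N M"
    using assms by (auto simp: tgamma_hom_def act_closed)
qed

lemma left_module_hom_ident:
  assumes "left_module R M" "carrier N = carrier M" "add N = add M"
    and "\<And>x m. \<lbrakk>x \<in> carrier R; m \<in> carrier M\<rbrakk> \<Longrightarrow> x \<odot>\<^bsub>N\<^esub> m = x \<odot>\<^bsub>M\<^esub> m"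
  shows "(\<lambda>m\<in>carrier M. m) \<in> left_module_hom R M N" "(\<lambda>m\<in>carrier M. m) \<in> left_module_hom R N M"
proof -
  interpret left_module R M by fact
  show "(\<lambda>m\<in>carrier M. m) \<in> left_module_hom R M N" "(\<lambda>m\<in>carrier M. m) \<in> left_module_hom R N M"
    using assms by (auto simp: left_module_hom_def smult_closed)
qed

section \<open>The functors, the unit and the counit\<close>

context ternary_gamma_ring
begin

lemma cat_functor_to_A_functor: "cat_functor (TGammaMod T \<Gamma>) (LeftMod (A_ring T \<Gamma>)) to_A_functor"
proof (intro cat_functor.intro cat_functor_axioms.intro category_TGammaMod category_LeftMod)
qed (auto simp: to_A_functor_def TGammaMod_def LeftMod_def
    intro: ternary_gamma_module.left_module_to_A_module tgamma_hom_imp_left_module_hom)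

lemma cat_functor_to_TGamma_functor:
  "cat_functor (LeftMod (A_ring T \<Gamma>)) (TGammaMod T \<Gamma>) (to_TGamma_functor T \<Gamma>)"
proof (intro cat_functor.intro cat_functor_axioms.intro category_TGammaMod category_LeftMod)
qed (auto simp: to_TGamma_functor_def TGammaMod_def LeftMod_def
    intro: ternary_gamma_module_to_TGamma_module left_module_hom_imp_tgamma_hom)

lemma natural_iso_TGammaMod:
  "natural_iso (TGammaMod T \<Gamma>) (TGammaMod T \<Gamma>) id_functor
    (comp_functor (to_TGamma_functor T \<Gamma>) to_A_functor) (\<lambda>M. \<lambda>m\<in>carrier M. m)"
  unfolding natural_iso_def
proof (intro conjI ballI)
  fix M assume "M \<in> Ob (TGammaMod T \<Gamma>)"
  then interpret M: ternary_gamma_module T \<Gamma> M by (simp add: TGammaMod_def)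
  let ?N = "to_TGamma_module T \<Gamma> (to_A_module M)"
  have "(\<lambda>m\<in>carrier M. m) \<in> tgamma_hom T \<Gamma> M ?N" "(\<lambda>m\<in>carrier M. m) \<in> tgamma_hom T \<Gamma> ?N M"
    using M.act_to_TGamma_module_to_A_module
    \<comment> \<open>The simp rule for the action is removed, as it would unfold the round-trip
      action before the round-trip lemma could match it.\<close>
    by (auto intro!: tgamma_hom_ident[OF M.ternary_gamma_module_axioms] simp del: to_TGamma_module_simps(4))
  then show "is_iso (TGammaMod T \<Gamma>) (fobj id_functor M)
      (fobj (comp_functor (to_TGamma_functor T \<Gamma>) to_A_functor) M) (\<lambda>m\<in>carrier M. m)"
    by (auto simp: is_iso_def TGammaMod_def id_functor_def comp_functor_def to_TGamma_functor_def
        to_A_functor_def compose_def intro!: bexI[of _ "\<lambda>m\<in>carrier M. m"])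
\<comment> \<open>Naturality: either composite is \<open>f\<close> on the carrier of its domain and
  \<open>undefined\<close> elsewhere, hence \<open>f\<close> itself.\<close>
qed (auto simp: TGammaMod_def id_functor_def comp_functor_def to_TGamma_functor_def
    to_A_functor_def compose_def tgamma_hom_def fun_eq_iff)

lemma natural_iso_LeftMod:
  "natural_iso (LeftMod (A_ring T \<Gamma>)) (LeftMod (A_ring T \<Gamma>))
    (comp_functor to_A_functor (to_TGamma_functor T \<Gamma>)) id_functor (\<lambda>M. \<lambda>m\<in>carrier M. m)"
  unfolding natural_iso_def
proof (intro conjI ballI)
  fix M assume "M \<in> Ob (LeftMod (A_ring T \<Gamma>))"
  then have M: "left_module (A_ring T \<Gamma>) M" by (simp add: LeftMod_def)
  let ?N = "to_A_module (to_TGamma_module T \<Gamma> M)"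
  have "(\<lambda>m\<in>carrier M. m) \<in> left_module_hom (A_ring T \<Gamma>) M ?N"
    "(\<lambda>m\<in>carrier M. m) \<in> left_module_hom (A_ring T \<Gamma>) ?N M"
    using smult_to_A_module_to_TGamma_module[OF M]
    by (auto intro!: left_module_hom_ident[OF M] simp del: to_A_module_simps(4))
  then show "is_iso (LeftMod (A_ring T \<Gamma>)) (fobj (comp_functor to_A_functor (to_TGamma_functor T \<Gamma>)) M)
      (fobj id_functor M) (\<lambda>m\<in>carrier M. m)"
    by (auto simp: is_iso_def LeftMod_def id_functor_def comp_functor_def to_TGamma_functor_def
        to_A_functor_def compose_def intro!: bexI[of _ "\<lambda>m\<in>carrier M. m"])
qed (auto simp: LeftMod_def id_functor_def comp_functor_def to_TGamma_functor_def
    to_A_functor_def compose_def left_module_hom_def fun_eq_iff)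

end

theorem theorem5p2:
  fixes T :: "('t, 'g) tgamma_ring" and \<Gamma> :: "'g ring"
  assumes "ternary_gamma_ring T \<Gamma>"
  shows "equivalence_of_categories
    (TGammaMod T \<Gamma> :: (('t, 'g, 'm) tgamma_module, 'm \<Rightarrow> 'm) category)
    (LeftMod (A_ring T \<Gamma>))
    to_A_functor
    (to_TGamma_functor T \<Gamma>)"
proof -
  interpret ternary_gamma_ring T \<Gamma> by fact
  show ?thesis
    unfolding equivalence_of_categories_def
    using cat_functor_to_A_functor cat_functor_to_TGamma_functor natural_iso_TGammaMod
      natural_iso_LeftMod by blast
qed

end
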